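(* Let $(P)$ be the problem in the context. Suppose that Assumption (D) (bounded domains), Assumption (S) (structure) and the constraint qualification $\mathbf{CQ}$ from the context hold. Let $(x^*,y^* )$ be a solution to $(P)$ and let $\{(x^t,y^t)\}$ be generated by the algorithm in the context with parameter $\delta\in(0,1)$. Then the quantity $\tau_t$ defined in the context satisfies $$\tau_t=\mathcal{O}\left(\max\{(t+1)^{-(1-\delta)},(t+1)^{-\nu},(t+1)^{-\mu}\}\right).$$ Moreover, with $$\varpi_1=\min\{1-\delta,\nu,\mu\},\qquad \varpi_2=\min\left\{\delta,\tfrac12,\tfrac{\nu+\delta}{2},\tfrac{\mu+\delta}{2}\right\},$$ it holds that $$\left|f(x^t)+g(y^t)-f(x^* )-g(y^* )\right|=\mathcal{O}\left((t+1)^{-\min\{\varpi_1,\varpi_2\}}\right)\quad\text{and}\quad\|Ax^t+By^t-c\|=\mathcal{O}\left((t+1)^{-\varpi_2}\right).$$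
   Context: Problem $(P)$: $\min_{x\in\mathcal{E}_1,y\in\mathcal{E}_2} f(x)+g(y)$ subject to $Ax+By=c$, where $\mathcal{E},\mathcal{E}_1,\mathcal{E}_2$ are finite dimensional (real) Hilbert spaces, $c\in\mathcal{E}$, $A:\mathcal{E}_1\to\mathcal{E}$ and $B:\mathcal{E}_2\to\mathcal{E}$ are linear, $f:\mathcal{E}_1\to(-\infty,\infty]$ and $g:\mathcal{E}_2\to(-\infty,\infty]$ are proper closed convex, and the solution set is nonempty. $A^*$ is the adjoint, $\lambda_{\max}$ the largest eigenvalue, $\operatorname{dom}$ the effective domain, $\mathrm{ri}$ the relative interior. Big-$\mathcal{O}$ is as $t\to\infty$, with constants independent of $t$. $\mathbf{CQ}$: $c\in A\,\mathrm{ri}(\operatorname{dom}f)+B\,\mathrm{ri}(\operatorname{dom}g)$. Assumption (D): $D_f:=\sup_{x_1,x_2\in\operatorname{dom}f}\|x_1-x_2\|<\infty$ and $D_g:=\sup_{y_1,y_2\in\operatorname{dom}g}\|y_1-y_2\|<\infty$. Assumption (S): $f=f_1+f_2$, $g=g_1+g_2$ with $f_1:\mathcal{E}_1\to\mathbb{R}$, $g_1:\mathcal{E}_2\to\mathbb{R}$ convex and smooth, $f_2:\mathcal{E}_1\to(-\infty,\infty]$, $g_2:\mathcal{E}_2\to(-\infty,\infty]$ proper closed convex; $\nabla f_1$ and $\nabla g_1$ are Hölder continuous on $\operatorname{dom}f$ and $\operatorname{dom}g$ respectively, and $\mu,\nu\in(0,1]$, $M_f,M_g\ge0$ are constants such that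 $f_1(y)\le f_1(x)+\langle\nabla f_1(x),y-x\rangle+\frac{M_f}{\mu+1}\|y-x\|^{\mu+1}$ for all $x,y\in\operatorname{dom}f$, and $g_1(y)\le g_1(x)+\langle\nabla g_1(x),y-x\rangle+\frac{M_g}{\nu+1}\|y-x\|^{\nu+1}$ for all $x,y\in\operatorname{dom}g$; and for every $v\in\mathcal{E}_2$ a minimizer of $y\mapsto\langle v,y\rangle+g_2(y)$ over $\mathcal{E}_2$ exists. (The paper also assumes that these minimizers and the proximal mappings of $\gamma f_2$, $\gamma>0$, can be computed efficiently.) Algorithm: choose $x^0\in\operatorname{dom}f$, $y^0\in\operatorname{dom}g$, $\beta_0>0$, $H_0>0$, $\delta\in(0,1)$; let $\lambda_A=\lambda_{\max}(A^*A)$. For $t=0,1,\dots$, with $\alpha_t=\frac{2}{t+2}$: $R^t=Ax^t+By^t-c$; $x^{t+1}=\arg\min_{x}\ \langle\nabla f_1(x^t)+\beta_tA^*R^t,x-x^t\rangle+\frac{H_t+\lambda_A\beta_t}{2}\|x-x^t\|^2+f_2(x)$; $\widetilde R^t=Ax^{t+1}+By^t-c$; $u^t\in\operatorname{Argmin}_{y}\ \langle\nabla g_1(y^t)+\beta_tB^*\widetilde R^t,y\rangle+g_2(y)$ (any minimizer); $y^{t+1}=y^t+\alpha_t(u^t-y^t)$; $H_{t+1}=\max\{H_0,\frac{2M_f}{\mu+1}\}(t+1)^{1-\mu}$, $\beta_{t+1}=\beta_0(t+2)^{\delta}$ (so $\beta_t=\beta_0(t+1)^\delta$ for all $t\ge0$).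 Definition of $\tau_t$ ($t\ge2$): $\tau_t=\frac{\omega_1}{t(t+1)}+\frac{\omega_2}{(t+1)^{1-\delta}}+\frac{\omega_3}{(t+1)^{\nu}}+\frac{\omega_4}{(t+1)^{\mu}}$ if $\mu\in(0,1)$, and $\tau_t=\frac{\omega_1}{t(t+1)}+\frac{\omega_2}{(t+1)^{1-\delta}}+\frac{\omega_3}{(t+1)^{\nu}}+\frac{\omega_5}{t+1}$ if $\mu=1$, where $\omega_1=2^{\delta+3}\beta_0D_2+\vartheta$, $\omega_2=2\lambda_AD_f^2\beta_0+2\lambda_BD_g^2\beta_0+\frac{32+16\delta}{1+\delta}D_2\beta_0$, $\omega_3=\frac{2^{\nu+1}}{\nu+1}M_gD_g^{\nu+1}$, $\omega_4=2\widetilde H_0D_f^2+2\omega_0$, $\omega_5=2\widetilde H_0D_f^2$, $\omega_0=4\widetilde H_0\left(\frac{2M_f}{(1+\mu)\widetilde H_0}\right)^{2/(1-\mu)}$, $\widetilde H_0=\max\{H_0,\frac{2M_f}{\mu+1}\}$, $\vartheta=2(f(x^1)+g(y^1)+\frac{\beta_0}{2}\|Ax^1+By^1-c\|^2-f(x^* )-g(y^* ))$, $\lambda_B=\lambda_{\max}(B^*B)$, $D_2=\sup_{x\in\operatorname{dom}f,y\in\operatorname{dom}g}|\langle Ax,By\rangle|$. *)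

theory Defs
  imports "HOL-Analysis.Analysis" "HOL-Library.Landau_Symbols"
begin

definition edom :: "('a \<Rightarrow> ereal) \<Rightarrow> 'a set" where
  "edom h = {x. h x < \<infinity>}"

definition epi :: "('a \<Rightarrow> ereal) \<Rightarrow> ('a \<times> real) set" where
  "epi h = {(x, r). h x \<le> ereal r}"

definition proper_closed_convex :: "('a::euclidean_space \<Rightarrow> ereal) \<Rightarrow> bool" where
  "proper_closed_convex h \<longleftrightarrow>
     (\<forall>x. h x \<noteq> -\<infinity>) \<and> edom h \<noteq> {} \<and> closed (epi h) \<and> convex (epi h)"

definition edom_diam :: "('a::euclidean_space \<Rightarrow> ereal) \<Rightarrow> ereal" where
  "edom_diam h = (SUP (x, y) \<in> edom h \<times> edom h. ereal (norm (x - y)))"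

definition eigenvalues :: "('a::euclidean_space \<Rightarrow> 'a) \<Rightarrow> real set" where
  "eigenvalues T = {l. \<exists>v. v \<noteq> 0 \<and> T v = l *\<^sub>R v}"

text \<open>Meaningful for self-adjoint linear maps, whose set of real eigenvalues is finite and
  nonempty.\<close>

definition lambda_max :: "('a::euclidean_space \<Rightarrow> 'a) \<Rightarrow> real" where
  "lambda_max T = Max (eigenvalues T)"

definition convex_smooth :: "('a::euclidean_space \<Rightarrow> real) \<Rightarrow> ('a \<Rightarrow> 'a) \<Rightarrow> bool" where
  "convex_smooth h G \<longleftrightarrow>
     convex_on UNIV h \<and> (\<forall>x. GDERIV h x :> G x) \<and> continuous_on UNIV G"

definition hoelder_continuous_on ::
  "'a::euclidean_space set \<Rightarrow> ('a \<Rightarrow> 'a) \<Rightarrow> bool" where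
  "hoelder_continuous_on S G \<longleftrightarrow>
     (\<exists>p L. 0 < p \<and> p \<le> 1 \<and> 0 \<le> L \<and>
        (\<forall>x\<in>S. \<forall>y\<in>S. norm (G x - G y) \<le> L * norm (x - y) powr p))"

definition is_solution ::
  "('a::euclidean_space \<Rightarrow> ereal) \<Rightarrow> ('b::euclidean_space \<Rightarrow> ereal) \<Rightarrow>
   ('a \<Rightarrow> 'c::euclidean_space) \<Rightarrow> ('b \<Rightarrow> 'c) \<Rightarrow> 'c \<Rightarrow> 'a \<Rightarrow> 'b \<Rightarrow> bool" where
  "is_solution f g A B c xs ys \<longleftrightarrow>
     is_arg_min (\<lambda>(x, y). f x + g y) (\<lambda>(x, y). A x + B y = c) (xs, ys)"

text \<open>The next lemmas show that solutions and iterates lie in the effective domains, so that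
  taking \<^const>\<open>real_of_ereal\<close> of the objective values there is harmless.\<close>

lemma solution_in_edom:
  assumes "\<And>x. f x \<noteq> -\<infinity>" "\<And>y. g y \<noteq> -\<infinity>"
    and "\<exists>x\<in>edom f. \<exists>y\<in>edom g. A x + B y = c"
    and "is_solution f g A B c xs ys"
  shows "xs \<in> edom f \<and> ys \<in> edom g"
proof -
  obtain x y where xy: "x \<in> edom f" "y \<in> edom g" "A x + B y = c" using assms(3) by blast
  have "f xs + g ys \<le> f x + g y"
    using assms(4) xy(3) unfolding is_solution_def is_arg_min_def by (auto simp: not_less)
  also have "\<dots> < \<infinity>" using xy by (auto simp: edom_def)
  finally show ?thesis
    using assms(1)[of xs] assms(2)[of ys] by (auto simp: edom_def)
qed

lemma arg_min_in_edom:
  assumes "\<And>z. h z \<noteq> -\<infinity>" "edom h \<noteq> {}"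
    and "is_arg_min (\<lambda>z. ereal (q z) + h z) (\<lambda>_. True) w"
  shows "w \<in> edom h"
proof -
  obtain z where z: "h z < \<infinity>" using assms(2) by (auto simp: edom_def)
  have "ereal (q w) + h w \<le> ereal (q z) + h z"
    using assms(3) unfolding is_arg_min_def by (auto simp: not_less)
  also have "\<dots> < \<infinity>" using z by auto
  finally show ?thesis by (auto simp: edom_def)
qed

lemma convex_edom:
  assumes "proper_closed_convex h"
  shows "convex (edom h)"
proof -
  have "edom h = fst ` epi h"
  proof (intro set_eqI iffI)
    fix x assume "x \<in> edom h"
    then have "h x \<le> ereal (real_of_ereal (h x))"
      using assms by (cases "h x") (auto simp: edom_def proper_closed_convex_def)
    then show "x \<in> fst ` epi h" by (force simp: epi_def)
  qed (auto simp: epi_def edom_def intro: le_less_trans)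
  moreover have "convex (fst ` epi h)"
    using assms by (intro convex_linear_image linear_fst) (simp add: proper_closed_convex_def)
  ultimately show ?thesis by simp
qed

lemma prox_iterates_in_edom:
  assumes "proper_closed_convex f2" "\<And>z. f z = ereal (f1 z) + f2 z" "x 0 \<in> edom f"
    and "\<And>t. is_arg_min (\<lambda>z. ereal (q t z) + f2 z) (\<lambda>_. True) (x (Suc t))"
  shows "x t \<in> edom f"
proof -
  have e: "edom f = edom f2" using assms(2) by (auto simp: edom_def)
  show ?thesis
    using assms arg_min_in_edom[of f2] e
    by (cases t) (auto simp: proper_closed_convex_def)
qed

lemma cond_grad_iterates_in_edom:
  fixes y :: "nat \<Rightarrow> 'b::euclidean_space"
  assumes "proper_closed_convex g2" "\<And>z. g z = ereal (g1 z) + g2 z" "y 0 \<in> edom g"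
    and "\<And>t. is_arg_min (\<lambda>z. ereal (q t z) + g2 z) (\<lambda>_. True) (u t)"
    and "\<And>t. y (Suc t) = y t + (2 / (real t + 2)) *\<^sub>R (u t - y t)"
  shows "y t \<in> edom g"
proof -
  have e: "edom g = edom g2" using assms(2) by (auto simp: edom_def)
  have u: "u t \<in> edom g2" for t
    using assms(1,4) arg_min_in_edom[of g2] by (auto simp: proper_closed_convex_def)
  have "y t \<in> edom g2"
  proof (induction t)
    case 0
    then show ?case using assms(3) e by simp
  next
    case (Suc t)
    have "y (Suc t) = (1 - 2 / (real t + 2)) *\<^sub>R y t + (2 / (real t + 2)) *\<^sub>R u t"
      by (simp add: assms(5) algebra_simps)
    also have "\<dots> \<in> edom g2"
      by (rule convexD[OF convex_edom[OF assms(1)] Suc.IH u]) auto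
    finally show ?case .
  qed
  then show ?thesis using e by simp
qed

end

theory Submission
  imports Defs
begin

text \<open>Comparing the proximal step with \<open>x\<^sup>t + \<alpha>\<^sub>t (x\<^sup>* - x\<^sup>t)\<close> and the conditional gradient step
  with \<open>y\<^sup>*\<close> bounds the penalised gap
  \<open>\<Psi>\<^sub>t = F(x\<^sup>t, y\<^sup>t) - F(x\<^sup>*, y\<^sup>*) + \<beta>\<^sub>t\<^sub>-\<^sub>1/2 \<parallel>A x\<^sup>t + B y\<^sup>t - c\<parallel>\<^sup>2\<close>, where \<open>F(x, y) = f(x) + g(y)\<close>, by
  \<open>(t+1)(t+2) \<Psi>\<^sub>t\<^sub>+\<^sub>1 \<le> t(t+1) \<Psi>\<^sub>t + 2(t+1)\<beta>\<^sub>t \<langle>A(x\<^sup>t\<^sup>+\<^sup>1 - x\<^sup>t), B(y\<^sup>* - y\<^sup>t)\<rangle> + O(t\<^sup>1\<^sup>-\<^sup>\<rho>)\<close>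
  with \<open>\<rho> = min {1 - \<delta>, \<nu>, \<mu>}\<close>. Summation by parts handles the inner products, so \<open>\<Psi>\<^sub>t = O(t\<^sup>-\<^sup>\<rho>)\<close>.
  Under the constraint qualification a Lagrange multiplier exists, so the gap in \<open>F\<close> is at least
  \<open>- K\<close> times the constraint violation; the bound on \<open>\<Psi>\<^sub>t\<close> is then a quadratic inequality
  for the violation, which gives both rates.\<close>

section \<open>A linear lower bound from the constraint qualification\<close>

text \<open>Scaling the normal \<open>(a, b)\<close> of a supporting hyperplane to
  \<open>b = 1\<close> gives a Lagrange multiplier, and Cauchy-Schwarz turns its norm into
  \<open>K\<close>: leaving the feasible set lowers the objective by at most \<open>K\<close> times
  the violation.\<close>

lemma convex_program_exact_penalty:
  fixes L :: "'a::euclidean_space \<Rightarrow> 'b::euclidean_space" and F :: "'a \<Rightarrow> real"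
  assumes lin: "linear L" and F: "convex_on P F"
    and z0: "z0 \<in> rel_interior P" "L z0 = c"
    and zs: "zs \<in> P" "L zs = c"
    and opt: "\<And>z. z \<in> P \<Longrightarrow> L z = c \<Longrightarrow> F zs \<le> F z"
  obtains K where "0 \<le> K" and "\<And>z. z \<in> P \<Longrightarrow> F zs - K * norm (L z - c) \<le> F z"
proof -
  have P: "convex P" using F by (rule convex_on_imp_convex)
  define C where "C = {(L z - c, s) | z s. z \<in> P \<and> F z \<le> s}"
  have "C = (\<lambda>(z, s). (L z - c, s)) ` epigraph P F"
    by (auto simp: C_def epigraph_def)
  also have "\<dots> = (+) (- c, 0) ` ((\<lambda>p. (L (fst p), snd p)) ` epigraph P F)"
    by (force simp: image_image case_prod_beta)
  also have "convex \<dots>"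
  proof (intro convex_translation convex_linear_image convex_epigraphI F)
    show "linear (\<lambda>p::'a \<times> real. (L (fst p), snd p))"
      using lin by (intro linearI) (auto simp: linear_add linear_cmul)
  qed
  finally have C: "convex C" .
  have in_C: "(0, F zs + r) \<in> C" if "0 \<le> r" for r
    using zs that by (auto simp: C_def intro!: exI[of _ zs])
  text \<open>A hyperplane supporting the epigraph \<open>C\<close> of the perturbation function at \<open>(0, F zs)\<close>
    yields the multiplier; the qualification on \<open>z0\<close> excludes a vertical one.\<close>
  have "(0, F zs) \<notin> rel_interior C"
  proof
    \<comment> \<open>The segment from \<open>(0, F zs + 1)\<close> could then be prolonged inside
      \<open>C\<close> beyond \<open>(0, F zs)\<close>, down to height
      \<open>F zs + 1 - e < F zs\<close>, and a feasible point would beat the optimum.\<close>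
    assume "(0, F zs) \<in> rel_interior C"
    then obtain e where e: "e > 1" "(1 - e) *\<^sub>R (0, F zs + 1) + e *\<^sub>R (0, F zs) \<in> C"
      using convex_rel_interior_iff[OF C] in_C[of 1] by fastforce
    then obtain z where "z \<in> P" "L z = c" "F z \<le> (1 - e) * (F zs + 1) + e * F zs"
      by (auto simp: C_def)
    with opt[of z] e show False by (simp add: algebra_simps)
  qed
  then obtain a b where ab: "\<And>p. p \<in> C \<Longrightarrow> (a, b) \<bullet> (0, F zs) \<le> (a, b) \<bullet> p"
    and strict: "\<And>p. p \<in> rel_interior C \<Longrightarrow> (a, b) \<bullet> (0, F zs) < (a, b) \<bullet> p"
    using supporting_hyperplane_rel_boundary[OF C, of "(0, F zs)"] in_C[of 0]
    by (metis add.right_neutral order_refl surj_pair)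
  have sep: "b * F zs \<le> a \<bullet> (L z - c) + b * s" if "z \<in> P" "F z \<le> s" for z s
    using ab[of "(L z - c, s)"] that by (auto simp: C_def)
  have "0 \<le> b" using sep[OF zs(1), of "F zs + 1"] zs by (simp add: algebra_simps)
  moreover have "b \<noteq> 0"
  proof
    assume b: "b = 0"
    \<comment> \<open>For \<open>b = 0\<close> the functional \<open>a \<bullet> (L z - c)\<close>
      is nonnegative on \<open>P\<close>. Going from \<open>z\<close> through \<open>z0\<close> and
      slightly further stays in \<open>P\<close> but multiplies \<open>L z - c\<close> by
      \<open>1 - e < 0\<close>, so the functional vanishes. This contradicts the strict separation
      on \<open>rel_interior C\<close>.\<close>
    have vanish: "a \<bullet> (L z - c) = 0" if z: "z \<in> P" for z
    proof -
      obtain e where e: "e > 1" "(1 - e) *\<^sub>R z + e *\<^sub>R z0 \<in> P"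
        using convex_rel_interior_iff[OF P] z0 z by blast
      have "L ((1 - e) *\<^sub>R z + e *\<^sub>R z0) - c = (1 - e) *\<^sub>R (L z - c)"
        using z0 by (simp only: linear_add[OF lin] linear_cmul[OF lin]) (simp add: algebra_simps)
      then have "0 \<le> (1 - e) * (a \<bullet> (L z - c))"
        using sep[OF e(2) order_refl] b by simp
      moreover have "0 \<le> a \<bullet> (L z - c)" using sep[OF z order_refl] b by simp
      ultimately show ?thesis using e(1) by (smt (verit) mult_neg_pos)
    qed
    obtain p where p: "p \<in> rel_interior C"
      using rel_interior_eq_empty[OF C] in_C[of 0] by auto
    then have "p \<in> C" using rel_interior_subset by blast
    then obtain z s where "p = (L z - c, s)" "z \<in> P" by (auto simp: C_def)
    then show False using strict[OF p] b vanish[of z] by simp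
  qed
  ultimately have b: "b > 0" by simp
  show thesis
  proof
    show "0 \<le> norm a / b" using b by simp
    fix z assume z: "z \<in> P"
    have "b * F zs \<le> norm a * norm (L z - c) + b * F z"
      using sep[OF z order_refl] norm_cauchy_schwarz[of a "L z - c"] by linarith
    then show "F zs - norm a / b * norm (L z - c) \<le> F z"
      using b by (simp add: field_simps)
  qed
qed

section \<open>Largest eigenvalue and operator norm\<close>

text \<open>Eigenvectors of a self-adjoint map for distinct eigenvalues are orthogonal, and a
  pairwise orthogonal set in a Euclidean space is finite. Finiteness is what gives the
  \<open>Max\<close> in \<open>lambda_max\<close> its meaning.\<close>

lemma finite_eigenvalues_adjoint_comp:
  fixes A :: "'a::euclidean_space \<Rightarrow> 'b::euclidean_space"
  assumes "linear A"
  shows "finite (eigenvalues (adjoint A \<circ> A))"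
proof -
  let ?T = "adjoint A \<circ> A"
  have "\<forall>l\<in>eigenvalues ?T. \<exists>v. v \<noteq> 0 \<and> ?T v = l *\<^sub>R v" by (simp add: eigenvalues_def)
  then obtain v where v: "\<And>l. l \<in> eigenvalues ?T \<Longrightarrow> v l \<noteq> 0 \<and> ?T (v l) = l *\<^sub>R v l"
    by metis
  have orth: "v k \<bullet> v l = 0" if "k \<in> eigenvalues ?T" "l \<in> eigenvalues ?T" "k \<noteq> l" for k l
  proof -
    have "k * (v k \<bullet> v l) = ?T (v k) \<bullet> v l" using v[OF that(1)] by simp
    also have "\<dots> = v k \<bullet> ?T (v l)" by (simp add: adjoint_clauses[OF assms])
    also have "\<dots> = l * (v k \<bullet> v l)" using v[OF that(2)] by simp
    finally show ?thesis using that(3) by simp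
  qed
  have "inj_on v (eigenvalues ?T)" using orth v by (metis inj_onI inner_eq_zero_iff)
  moreover have "pairwise orthogonal (v ` eigenvalues ?T)"
    using orth by (force simp: pairwise_def orthogonal_def)
  ultimately show ?thesis using pairwise_orthogonal_imp_finite finite_imageD by blast
qed

lemma norm_add_sq:
  fixes a b :: "'a::real_inner"
  shows "(norm (a + b))\<^sup>2 = (norm a)\<^sup>2 + 2 * (a \<bullet> b) + (norm b)\<^sup>2"
  by (simp add: power2_norm_eq_inner inner_add inner_commute)

text \<open>The Rayleigh quotient attains its maximum \<open>l\<close> on the compact unit sphere.
  First-order optimality makes the maximiser an eigenvector, so \<open>l\<close> is itself an
  eigenvalue.\<close>

lemma norm_sq_le_lambda_max:
  fixes A :: "'a::euclidean_space \<Rightarrow> 'b::euclidean_space"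
  assumes lin: "linear A"
  shows "(norm (A d))\<^sup>2 \<le> lambda_max (adjoint A \<circ> A) * (norm d)\<^sup>2"
proof -
  obtain b :: 'a where "b \<in> Basis" using nonempty_Basis by blast
  then have "sphere (0::'a) 1 \<noteq> {}" by (auto intro!: exI[of _ b])
  moreover have "continuous_on (sphere 0 1) (\<lambda>w. (norm (A w))\<^sup>2)"
    using lin by (intro continuous_intros linear_continuous_on linear_linear[THEN iffD1])
      (auto simp: linear_conv_bounded_linear)
  ultimately obtain v where v: "norm v = 1"
    and max: "\<And>w. norm w = 1 \<Longrightarrow> (norm (A w))\<^sup>2 \<le> (norm (A v))\<^sup>2"
    using continuous_attains_sup[OF compact_sphere[of 0 1], of "\<lambda>w. (norm (A w))\<^sup>2"] by auto
  define l where "l = (norm (A v))\<^sup>2"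
  have bound: "(norm (A w))\<^sup>2 \<le> l * (norm w)\<^sup>2" for w
  proof (cases "w = 0")
    case False
    then have "(norm (A (w /\<^sub>R norm w)))\<^sup>2 \<le> l" unfolding l_def by (intro max) simp
    then show ?thesis using False by (simp add: linear_cmul[OF lin] field_simps power2_eq_square)
  qed (simp add: linear_0[OF lin])
  \<comment> \<open>Perturbing \<open>v\<close> to \<open>v + s *\<^sub>R w\<close> in the Rayleigh
    bound gives \<open>2 * s * p + s\<^sup>2 * q \<ge> 0\<close> for every \<open>s\<close>, which
    forces the linear coefficient \<open>p\<close> to vanish.\<close>
  have "w \<bullet> (l *\<^sub>R v - adjoint A (A v)) = 0" for w
  proof -
    define p where "p = w \<bullet> (l *\<^sub>R v - adjoint A (A v))"
    define q where "q = l * (norm w)\<^sup>2 - (norm (A w))\<^sup>2"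
    have p: "p = l * (v \<bullet> w) - A v \<bullet> A w"
      by (simp add: p_def inner_diff_right adjoint_clauses[OF lin] inner_commute)
    have pos: "0 \<le> 2 * s * p + s\<^sup>2 * q" for s
    proof -
      have "(norm (A (v + s *\<^sub>R w)))\<^sup>2 = l + 2 * s * (A v \<bullet> A w) + s\<^sup>2 * (norm (A w))\<^sup>2"
        by (simp add: linear_add[OF lin] linear_cmul[OF lin] norm_add_sq l_def power_mult_distrib)
      moreover have "(norm (v + s *\<^sub>R w))\<^sup>2 = 1 + 2 * s * (v \<bullet> w) + s\<^sup>2 * (norm w)\<^sup>2"
        using v by (simp add: norm_add_sq power_mult_distrib)
      ultimately show ?thesis
        using bound[of "v + s *\<^sub>R w"] by (simp add: p q_def algebra_simps)
    qed
    have "0 \<le> q" using bound[of w] by (simp add: q_def)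
    \<comment> \<open>With \<open>s = - p * k\<close> the quadratic equals
      \<open>- k * (2 - k * q) * p\<^sup>2\<close>. Adding 1 in the denominator keeps
      \<open>k\<close> defined for \<open>q = 0\<close> and ensures
      \<open>k * q < 1\<close>.\<close>
    define k where "k = 1 / (q + 1)"
    have k: "0 < k" "0 < 2 - k * q" using \<open>0 \<le> q\<close> by (simp_all add: k_def field_simps)
    have "0 \<le> - (k * (2 - k * q)) * p\<^sup>2"
      using pos[of "- p * k"] by (simp add: power2_eq_square algebra_simps)
    moreover have "0 < k * (2 - k * q)" using k by simp
    ultimately have "p\<^sup>2 \<le> 0" by (smt (verit) mult_neg_pos)
    then show ?thesis by (simp add: p_def)
  qed
  then have "l *\<^sub>R v - adjoint A (A v) = 0" by (metis inner_eq_zero_iff)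
  then have "l \<in> eigenvalues (adjoint A \<circ> A)"
    using v by (auto simp: eigenvalues_def intro!: exI[of _ v])
  then have "l \<le> lambda_max (adjoint A \<circ> A)"
    unfolding lambda_max_def by (intro Max_ge finite_eigenvalues_adjoint_comp lin)
  then show ?thesis using bound[of d] by (meson mult_right_mono order_trans zero_le_power2)
qed

section \<open>Extended-real convex functions\<close>

text \<open>Restriction to the line through \<open>v\<close> and \<open>w\<close> reduces this to
  the tangent inequality for convex functions of one real variable.\<close>

lemma convex_smooth_tangent_le:
  assumes "convex_smooth h G"
  shows "h v + G v \<bullet> (w - v) \<le> h w"
proof -
  define k where "k = (\<lambda>s. h (v + s *\<^sub>R (w - v)))"
  have h: "convex_on UNIV h" and G: "\<And>x. (h has_derivative (\<lambda>d. d \<bullet> G x)) (at x)"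
    using assms by (auto simp: convex_smooth_def gderiv_def)
  have "convex_on UNIV k"
  proof (rule convex_onI)
    fix t a b :: real assume t: "0 < t" "t < 1"
    have "v + ((1 - t) * a + t * b) *\<^sub>R (w - v)
        = (1 - t) *\<^sub>R (v + a *\<^sub>R (w - v)) + t *\<^sub>R (v + b *\<^sub>R (w - v))"
      by (simp add: algebra_simps)
    then show "k ((1 - t) *\<^sub>R a + t *\<^sub>R b) \<le> (1 - t) * k a + t * k b"
      using convex_onD[OF h, of t] t by (simp add: k_def)
  qed simp
  moreover have "(k has_field_derivative (G v \<bullet> (w - v))) (at 0)"
  proof -
    have "((\<lambda>s::real. v + s *\<^sub>R (w - v)) has_derivative (\<lambda>s. s *\<^sub>R (w - v))) (at 0)"
      by (auto intro!: derivative_eq_intros)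
    from has_derivative_compose[OF this G] show ?thesis
      by (simp add: k_def has_field_derivative_def inner_commute mult_commute_abs)
  qed
  ultimately have "k 1 - k 0 \<ge> (G v \<bullet> (w - v)) * (1 - 0)"
    using convex_on_imp_above_tangent[of UNIV k 0 1 "G v \<bullet> (w - v)"] by simp
  then show ?thesis by (simp add: k_def)
qed

text \<open>Since \<open>h\<close> never takes the value \<open>-\<infinity>\<close>, the epigraph
  of its real-valued restriction to the effective domain is exactly \<open>epi h\<close>.\<close>

lemma proper_closed_convex_convex_on:
  assumes h: "proper_closed_convex h"
  shows "convex_on (edom h) (\<lambda>z. real_of_ereal (h z))"
proof -
  have "epigraph (edom h) (\<lambda>z. real_of_ereal (h z)) = epi h"
  proof (intro set_eqI)
    fix p :: "'a \<times> real"
    obtain z r where p: "p = (z, r)" by (cases p)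
    have "h z \<noteq> -\<infinity>" using h by (auto simp: proper_closed_convex_def)
    then show "p \<in> epigraph (edom h) (\<lambda>z. real_of_ereal (h z)) \<longleftrightarrow> p \<in> epi h"
      by (cases "h z") (auto simp: p epigraph_def epi_def edom_def)
  qed
  then show ?thesis using h by (simp add: convex_epigraph[symmetric] proper_closed_convex_def)
qed

lemma is_arg_min_edom_le:
  assumes h: "proper_closed_convex h"
    and min: "is_arg_min (\<lambda>z. ereal (q z) + h z) (\<lambda>_. True) p" and w: "w \<in> edom h"
  shows "q p + real_of_ereal (h p) \<le> q w + real_of_ereal (h w)"
proof -
  have "h p \<noteq> -\<infinity>" "h w \<noteq> -\<infinity>" using h by (auto simp: proper_closed_convex_def)
  moreover have "ereal (q p) + h p \<le> ereal (q w) + h w"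
    using min by (auto simp: is_arg_min_def not_less)
  ultimately show ?thesis using w by (cases "h p"; cases "h w") (auto simp: edom_def)
qed

lemma bounded_edom:
  assumes "edom_diam h < \<infinity>"
  obtains D where "0 \<le> D" "\<And>v w. v \<in> edom h \<Longrightarrow> w \<in> edom h \<Longrightarrow> norm (v - w) \<le> D"
proof
  fix v w assume "v \<in> edom h" "w \<in> edom h"
  then have "ereal (norm (v - w)) \<le> edom_diam h"
    unfolding edom_diam_def by (intro SUP_upper2[of "(v, w)"]) auto
  with assms show "norm (v - w) \<le> max 0 (real_of_ereal (edom_diam h))"
    by (cases "edom_diam h") auto
qed simp

section \<open>One step of the algorithm\<close>

lemma hoelder_term_le:
  fixes \<mu> m s t h :: real
  assumes "0 < \<mu>" "\<mu> \<le> 1" "0 \<le> m" "0 \<le> s" "0 < t" and h: "2 * m * t powr (1 - \<mu>) \<le> h"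
  shows "m * s powr (\<mu> + 1) - h / 2 * s\<^sup>2 \<le> m * t powr (- (1 + \<mu>))"
  \<comment> \<open>For \<open>s \<ge> 1 / t\<close> the quadratic term dominates; below, the power term itself is small.\<close>
proof (cases "s < 1 / t")
  case True
  have "s powr (\<mu> + 1) \<le> (1 / t) powr (\<mu> + 1)"
    using assms True by (intro powr_mono2) auto
  also have "\<dots> = t powr (- (1 + \<mu>))"
    using \<open>0 < t\<close> by (simp only: add.commute[of \<mu>] powr_divide powr_minus_divide) simp
  finally have "m * s powr (\<mu> + 1) \<le> m * t powr (- (1 + \<mu>))"
    using \<open>0 \<le> m\<close> by (intro mult_left_mono)
  moreover have "0 \<le> 2 * m * t powr (1 - \<mu>)" using \<open>0 \<le> m\<close> by simp
  then have "0 \<le> h / 2 * s\<^sup>2" using h by simp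
  ultimately show ?thesis by linarith
next
  case False
  then have s: "1 / t \<le> s" "0 < s" using \<open>0 < t\<close> by (auto simp: not_less intro: less_le_trans[of 0 "1 / t"])
  \<comment> \<open>The exponent \<open>\<mu> - 1\<close> is nonpositive, so the lower bound
    \<open>1 / t \<le> s\<close> bounds the first factor from above by
    \<open>t powr (1 - \<mu>)\<close>.\<close>
  have "s powr (\<mu> + 1) = s powr (\<mu> - 1) * s powr 2"
    by (simp add: powr_add[symmetric] add.commute)
  also have "\<dots> = s powr (\<mu> - 1) * s\<^sup>2" using s by (simp add: powr_numeral)
  also have "s powr (\<mu> - 1) \<le> (1 / t) powr (\<mu> - 1)"
    using assms s by (intro powr_mono2') auto
  also have "(1 / t) powr (\<mu> - 1) = t powr (1 - \<mu>)"
    using \<open>0 < t\<close> by (simp add: powr_divide powr_minus_divide[symmetric])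
  finally have "m * s powr (\<mu> + 1) \<le> m * (t powr (1 - \<mu>) * s\<^sup>2)"
    using \<open>0 \<le> m\<close> by (simp add: mult_left_mono mult_right_mono)
  also have "\<dots> = (2 * m * t powr (1 - \<mu>)) / 2 * s\<^sup>2" by simp
  also have "\<dots> \<le> h / 2 * s\<^sup>2" using h by (intro mult_right_mono divide_right_mono) auto
  finally show ?thesis using \<open>0 \<le> m\<close> by (smt (verit) mult_nonneg_nonneg powr_ge_zero)
qed

text \<open>The minimality of \<open>p\<close> is tested at a convex combination of \<open>x\<close>
  and \<open>z\<close>. The part \<open>lam * \<beta>\<close> of the proximal weight pays for the
  curvature of the penalty; the part \<open>h\<close> is left over to absorb the smoothness
  remainder \<open>e\<close>.\<close>

lemma proximal_gradient_step_le:
  fixes A :: "'a::euclidean_space \<Rightarrow> 'c::euclidean_space" and f1 f2 :: "'a \<Rightarrow> real"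
  assumes lin: "linear A" and f2: "convex_on X f2" and mem: "x \<in> X" "z \<in> X"
    and \<alpha>: "0 \<le> \<alpha>" "\<alpha> \<le> 1" and \<beta>: "0 \<le> \<beta>"
    and lam: "\<And>d. (norm (A d))\<^sup>2 \<le> lam * (norm d)\<^sup>2"
    and min: "\<And>w. w \<in> X \<Longrightarrow>
      (G + \<beta> *\<^sub>R adjoint A r) \<bullet> (p - x) + (h + lam * \<beta>) / 2 * (norm (p - x))\<^sup>2 + f2 p
      \<le> (G + \<beta> *\<^sub>R adjoint A r) \<bullet> (w - x) + (h + lam * \<beta>) / 2 * (norm (w - x))\<^sup>2 + f2 w"
    and upper: "f1 p \<le> f1 x + G \<bullet> (p - x) + e"
    and tangent: "f1 x + G \<bullet> (z - x) \<le> f1 z"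
  shows "f1 p + f2 p + \<beta> / 2 * (norm (r + A (p - x)))\<^sup>2
    \<le> (1 - \<alpha>) * (f1 x + f2 x) + \<alpha> * (f1 z + f2 z) + \<beta> / 2 * (norm r)\<^sup>2
      + \<alpha> * \<beta> * (r \<bullet> A (z - x)) + (h + lam * \<beta>) / 2 * \<alpha>\<^sup>2 * (norm (z - x))\<^sup>2
      + (e - h / 2 * (norm (p - x))\<^sup>2)"
proof -
  \<comment> \<open>Because \<open>w - x\<close> is \<open>\<alpha>\<close> times
    \<open>z - x\<close>, the proximal term costs only order \<open>\<alpha>\<^sup>2\<close>, while
    convexity yields the weights \<open>1 - \<alpha>\<close> and \<open>\<alpha>\<close>.\<close>
  define w where "w = (1 - \<alpha>) *\<^sub>R x + \<alpha> *\<^sub>R z"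
  have w: "w \<in> X" "f2 w \<le> (1 - \<alpha>) * f2 x + \<alpha> * f2 z"
    using f2 mem \<alpha> by (auto simp: w_def convex_on_def intro: convexD)
  have wx: "w - x = \<alpha> *\<^sub>R (z - x)" by (simp add: w_def algebra_simps)
  have adj: "adjoint A r \<bullet> d = r \<bullet> A d" for d by (simp add: adjoint_clauses[OF lin])
  have "G \<bullet> (p - x) + \<beta> * (r \<bullet> A (p - x)) + (h + lam * \<beta>) / 2 * (norm (p - x))\<^sup>2 + f2 p
    \<le> \<alpha> * (G \<bullet> (z - x)) + \<alpha> * \<beta> * (r \<bullet> A (z - x))
      + (h + lam * \<beta>) / 2 * \<alpha>\<^sup>2 * (norm (z - x))\<^sup>2 + f2 w"
    using min[OF w(1)] unfolding wx
    by (simp only: inner_add_left inner_scaleR_left inner_scaleR_right adj linear_cmul[OF lin]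
        norm_scaleR power_mult_distrib power2_abs distrib_left mult_ac)
  moreover have "\<alpha> * (f1 x + G \<bullet> (z - x)) \<le> \<alpha> * f1 z"
    using tangent \<alpha> by (intro mult_left_mono)
  moreover have "\<beta> / 2 * (norm (r + A (p - x)))\<^sup>2
    \<le> \<beta> / 2 * (norm r)\<^sup>2 + \<beta> * (r \<bullet> A (p - x)) + \<beta> / 2 * (lam * (norm (p - x))\<^sup>2)"
    using mult_left_mono[OF lam[of "p - x"], of "\<beta> / 2"] \<beta> by (simp add: norm_add_sq algebra_simps)
  ultimately show ?thesis using upper w(2) by (simp add: algebra_simps add_divide_distrib)
qed

text \<open>Minimality of \<open>u\<close> for the linearised problem is tested at \<open>z\<close>
  and scaled by \<open>\<alpha>\<close>. The penalty is expanded exactly along the segment to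
  \<open>u\<close>, which leaves an error of order \<open>\<alpha>\<^sup>2\<close> besides
  \<open>e\<close>.\<close>

lemma conditional_gradient_step_le:
  fixes B :: "'a::euclidean_space \<Rightarrow> 'c::euclidean_space" and g1 g2 :: "'a \<Rightarrow> real"
  assumes lin: "linear B" and g2: "convex_on Y g2" and mem: "y \<in> Y" "u \<in> Y" "z \<in> Y"
    and \<alpha>: "0 \<le> \<alpha>" "\<alpha> \<le> 1"
    and min: "(G + \<beta> *\<^sub>R adjoint B r) \<bullet> u + g2 u \<le> (G + \<beta> *\<^sub>R adjoint B r) \<bullet> z + g2 z"
    and p: "p = y + \<alpha> *\<^sub>R (u - y)"
    and upper: "g1 p \<le> g1 y + G \<bullet> (p - y) + e"
    and tangent: "g1 y + G \<bullet> (z - y) \<le> g1 z"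
  shows "g1 p + g2 p + \<beta> / 2 * (norm (r + B (p - y)))\<^sup>2
    \<le> (1 - \<alpha>) * (g1 y + g2 y) + \<alpha> * (g1 z + g2 z) + \<beta> / 2 * (norm r)\<^sup>2
      + \<alpha> * \<beta> * (r \<bullet> B (z - y)) + \<beta> / 2 * \<alpha>\<^sup>2 * (norm (B (u - y)))\<^sup>2 + e"
proof -
  have p': "p = (1 - \<alpha>) *\<^sub>R y + \<alpha> *\<^sub>R u" and py: "p - y = \<alpha> *\<^sub>R (u - y)"
    by (simp_all add: p algebra_simps)
  have g2p: "g2 p \<le> (1 - \<alpha>) * g2 y + \<alpha> * g2 u"
    unfolding p' using g2 mem \<alpha> by (auto simp: convex_on_def)
  have "G \<bullet> (u - y) + \<beta> * (r \<bullet> B (u - y)) + g2 u \<le> G \<bullet> (z - y) + \<beta> * (r \<bullet> B (z - y)) + g2 z"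
    using min by (simp add: inner_add_left inner_diff_right adjoint_clauses[OF lin]
        linear_diff[OF lin] algebra_simps)
  also have "\<dots> \<le> g1 z - g1 y + \<beta> * (r \<bullet> B (z - y)) + g2 z" using tangent by simp
  finally have "\<alpha> * (G \<bullet> (u - y) + \<beta> * (r \<bullet> B (u - y)) + g2 u)
    \<le> \<alpha> * (g1 z - g1 y + \<beta> * (r \<bullet> B (z - y)) + g2 z)"
    using \<alpha>(1) by (rule mult_left_mono)
  moreover have "\<beta> / 2 * (norm (r + B (p - y)))\<^sup>2
    = \<beta> / 2 * (norm r)\<^sup>2 + \<alpha> * \<beta> * (r \<bullet> B (u - y)) + \<beta> / 2 * \<alpha>\<^sup>2 * (norm (B (u - y)))\<^sup>2"
    unfolding py
    by (simp add: norm_add_sq linear_cmul[OF lin] power_mult_distrib distrib_left del: inner_diff_right)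
  moreover have "g1 p \<le> g1 y + \<alpha> * (G \<bullet> (u - y)) + e" using upper by (simp add: py)
  ultimately show ?thesis using g2p by (simp add: algebra_simps add_divide_distrib)
qed

section \<open>Convergence rates from the recursion\<close>

text \<open>Factoring out the square leaves \<open>r powr (\<delta> - 1)\<close>, which is
  nonincreasing; the difference is then at most \<open>(2 * p + 1) * p powr (\<delta> - 1)\<close>.
  This quantifies the slow variation of the weight in the summation by parts.\<close>

lemma powr_Suc_diff_le:
  fixes p \<delta> :: real
  assumes "1 \<le> p" "\<delta> \<le> 1"
  shows "(p + 1) powr (1 + \<delta>) - p powr (1 + \<delta>) \<le> 3 * p powr \<delta>"
proof -
  have sq: "r powr (1 + \<delta>) = r\<^sup>2 * r powr (\<delta> - 1)" if "0 < r" for r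
  proof -
    have "r powr (1 + \<delta>) = r powr 2 * r powr (\<delta> - 1)" by (simp add: powr_add[symmetric])
    then show ?thesis using that by (simp add: powr_numeral)
  qed
  have "(p + 1) powr (1 + \<delta>) = (p + 1)\<^sup>2 * (p + 1) powr (\<delta> - 1)" using sq[of "p + 1"] assms by simp
  also have "\<dots> \<le> (p + 1)\<^sup>2 * p powr (\<delta> - 1)"
    using assms by (intro mult_left_mono powr_mono2') auto
  finally have "(p + 1) powr (1 + \<delta>) - p powr (1 + \<delta>) \<le> (2 * p + 1) * p powr (\<delta> - 1)"
    using sq[of p] assms by (simp add: power2_eq_square algebra_simps)
  also have "\<dots> \<le> (3 * p) * p powr (\<delta> - 1)" using assms by (intro mult_right_mono) auto
  also have "\<dots> = 3 * p powr \<delta>" using assms by (simp add: powr_mult_base)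
  finally show ?thesis .
qed

text \<open>To be used with \<open>G\<close> the objective gap, \<open>n\<close> the constraint
  violation, \<open>a t = A (x t)\<close> and \<open>b t = B (ys - y t)\<close>. Multiplying by
  \<open>(t + 1) * (t + 2)\<close> makes the factors \<open>1 - \<alpha> t\<close> telescope. The
  product term is controlled because \<open>a\<close> is bounded and \<open>b\<close> moves by order
  \<open>\<alpha> t\<close>.\<close>

lemma penalty_recursion_rate:
  fixes G n :: "nat \<Rightarrow> real" and a b :: "nat \<Rightarrow> 'c::real_inner" and \<beta>0 \<delta> \<rho> E Ka Kb :: real
  defines "\<alpha> \<equiv> \<lambda>t. 2 / (real t + 2)" and "\<beta> \<equiv> \<lambda>t. \<beta>0 * (real t + 1) powr \<delta>"
  assumes \<delta>: "0 < \<delta>" "\<delta> < 1" and \<rho>: "\<rho> \<le> 1 - \<delta>" and \<beta>0: "0 < \<beta>0" and E: "0 \<le> E"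
    and step: "\<And>t. 1 \<le> t \<Longrightarrow> G (Suc t) + \<beta> t / 2 * (n (Suc t))\<^sup>2
      \<le> (1 - \<alpha> t) * G t + (1 / 2 - \<alpha> t) * \<beta> t * (n t)\<^sup>2
        + \<alpha> t * \<beta> t * ((a (Suc t) - a t) \<bullet> b t) + E * (real t + 1) powr (- 1 - \<rho>)"
    and a: "\<And>t. norm (a t) \<le> Ka" and b: "\<And>t. norm (b t) \<le> Kb"
    and b_diff: "\<And>t. norm (b (Suc t) - b t) \<le> \<alpha> t * Kb"
  obtains C where "0 \<le> C"
    and "\<And>t. 1 \<le> t \<Longrightarrow> G t + \<beta>0 / 4 * (real t + 1) powr \<delta> * (n t)\<^sup>2 \<le> C * (real t + 1) powr (- \<rho>)"
proof -
  define q where "q = 1 - \<rho>"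
  have q: "\<delta> \<le> q" "0 \<le> q" using \<rho> \<delta> by (auto simp: q_def)
  have K: "0 \<le> Ka" "0 \<le> Kb" using a[of 0] b[of 0] by (meson norm_ge_zero order_trans)+
  \<comment> \<open>The penalty weight lags by one index, since the step from \<open>t\<close>
    leaves weight \<open>\<beta> t\<close> on \<open>n (Suc t)\<close>. The natural-number
    subtraction is genuine for \<open>t \<ge> 1\<close>.\<close>
  define \<Psi> where "\<Psi> t = G t + \<beta> (t - 1) / 2 * (n t)\<^sup>2" for t
  define w where "w t = 2 * \<beta>0 * (real t + 1) powr (1 + \<delta>)" for t
  have w_eq: "w t = 2 * (real t + 1) * \<beta> t" for t by (simp add: w_def \<beta>_def powr_add)
  text \<open>The product term is not small, but its coefficient \<open>w\<close> varies slowly; subtracting it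
    inside the potential performs the summation by parts.\<close>
  define Z where "Z t = real t * (real t + 1) * \<Psi> t - w t * (a t \<bullet> b t)" for t
  \<comment> \<open>The extra \<open>- \<alpha> t\<close> compensates the growth of
    \<open>\<beta>\<close>: the claim amounts to
    \<open>(t - 2) * (t + 1) powr \<delta> \<le> t * t powr \<delta>\<close>. For
    \<open>t > 2\<close> it follows from
    \<open>((t + 1) / t) powr \<delta> \<le> (t + 1) / t\<close> and
    \<open>(t - 2) * (t + 1) \<le> t\<^sup>2\<close>.\<close>
  have \<beta>_le: "(1 / 2 - \<alpha> t) * \<beta> t \<le> (1 - \<alpha> t) * (\<beta> (t - 1) / 2)" if t: "1 \<le> t" for t
  proof -
    have t0: "0 < real t" using t by simp
    have "(real t + 1) powr \<delta> = real t powr \<delta> * ((real t + 1) / real t) powr \<delta>"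
      using t0 by (simp add: powr_divide)
    also have "\<dots> \<le> real t powr \<delta> * ((real t + 1) / real t) powr 1"
      using \<delta> t0 by (intro mult_left_mono powr_mono) auto
    finally have le: "(real t + 1) powr \<delta> \<le> real t powr \<delta> * ((real t + 1) / real t)"
      using t0 by simp
    have "(real t - 2) * (real t + 1) powr \<delta> \<le> real t * real t powr \<delta>"
    proof (cases "real t \<le> 2")
      case True
      then have "(real t - 2) * (real t + 1) powr \<delta> \<le> 0" by (simp add: mult_nonpos_nonneg)
      also have "0 \<le> real t * real t powr \<delta>" by simp
      finally show ?thesis .
    next
      case False
      then have "(real t - 2) * (real t + 1) powr \<delta>
          \<le> (real t - 2) * (real t powr \<delta> * ((real t + 1) / real t))"
        using le by (intro mult_left_mono) auto
      also have "\<dots> = real t powr \<delta> * ((real t - 2) * (real t + 1) / real t)" by simp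
      also have "\<dots> \<le> real t powr \<delta> * real t"
        using t0 by (intro mult_left_mono) (auto simp: field_simps)
      finally show ?thesis by (simp add: mult.commute)
    qed
    then have "\<beta>0 * ((real t - 2) * (real t + 1) powr \<delta>) \<le> \<beta>0 * (real t * real t powr \<delta>)"
      using \<beta>0 by (intro mult_left_mono) auto
    then have "\<beta>0 * ((real t - 2) * (real t + 1) powr \<delta>) / (2 * (real t + 2))
        \<le> \<beta>0 * (real t * real t powr \<delta>) / (2 * (real t + 2))"
      by (intro divide_right_mono) auto
    moreover have "1 / 2 - \<alpha> t = (real t - 2) / (2 * (real t + 2))"
      and "1 - \<alpha> t = real t / (real t + 2)"
      by (simp_all add: \<alpha>_def field_simps)
    ultimately show ?thesis using t by (simp add: \<beta>_def of_nat_diff mult_ac)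
  qed
  have \<Psi>_step: "(real t + 1) * (real t + 2) * \<Psi> (Suc t)
      \<le> real t * (real t + 1) * \<Psi> t + w t * ((a (Suc t) - a t) \<bullet> b t)
        + 2 * E * (real t + 1) powr q" if t: "1 \<le> t" for t
  proof -
    let ?p = "real t + 1"
    have "\<Psi> (Suc t) \<le> (1 - \<alpha> t) * \<Psi> t + \<alpha> t * \<beta> t * ((a (Suc t) - a t) \<bullet> b t)
        + E * ?p powr (- 1 - \<rho>)"
      using step[OF t] mult_right_mono[OF \<beta>_le[OF t], of "(n t)\<^sup>2"]
      by (simp add: \<Psi>_def algebra_simps diff_divide_distrib)
    then have "?p * (real t + 2) * \<Psi> (Suc t) \<le> ?p * (real t + 2) *
       ((1 - \<alpha> t) * \<Psi> t + \<alpha> t * \<beta> t * ((a (Suc t) - a t) \<bullet> b t) + E * ?p powr (- 1 - \<rho>))"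
      by (intro mult_left_mono) auto
    also have "\<dots> = ?p * ((real t + 2) * (1 - \<alpha> t)) * \<Psi> t
        + ?p * ((real t + 2) * \<alpha> t) * \<beta> t * ((a (Suc t) - a t) \<bullet> b t)
        + (real t + 2) * (E * (?p * ?p powr (- 1 - \<rho>)))"
      by (simp only: algebra_simps)
    also have "(real t + 2) * (1 - \<alpha> t) = real t" by (simp add: \<alpha>_def field_simps)
    also have "(real t + 2) * \<alpha> t = 2" by (simp add: \<alpha>_def field_simps)
    also have "?p * ?p powr (- 1 - \<rho>) = ?p powr (- \<rho>)" by (simp add: powr_mult_base)
    also have "(real t + 2) * (E * ?p powr (- \<rho>)) \<le> (2 * ?p) * (E * ?p powr (- \<rho>))"
      using E by (intro mult_right_mono) auto
    also have "(2 * ?p) * (E * ?p powr (- \<rho>)) = 2 * E * (?p * ?p powr (- \<rho>))" by simp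
    also have "?p * ?p powr (- \<rho>) = ?p powr q" by (simp add: powr_mult_base q_def)
    finally show ?thesis by (simp add: w_eq mult_ac)
  qed
  \<comment> \<open>The 10 is 6 from the increment of \<open>w\<close> plus 4 from
    \<open>w t * \<alpha> t\<close>, the weight on the increment of \<open>b\<close>.\<close>
  define M where "M = 10 * \<beta>0 * Ka * Kb + 2 * E"
  have M: "0 \<le> M" using \<beta>0 K E by (simp add: M_def)
  have Z_step: "Z (Suc t) \<le> Z t + M * (real t + 1) powr q" if t: "1 \<le> t" for t
  proof -
    let ?p = "real t + 1"
    have w_diff: "0 \<le> w (Suc t) - w t" "w (Suc t) - w t \<le> 6 * \<beta>0 * ?p powr \<delta>"
    proof -
      have "?p powr (1 + \<delta>) \<le> (?p + 1) powr (1 + \<delta>)" using \<delta> by (intro powr_mono2) auto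
      then show "0 \<le> w (Suc t) - w t" using \<beta>0 by (simp add: w_def add.commute)
      have "2 * \<beta>0 * ((?p + 1) powr (1 + \<delta>) - ?p powr (1 + \<delta>)) \<le> 2 * \<beta>0 * (3 * ?p powr \<delta>)"
        using \<delta> \<beta>0 by (intro mult_left_mono powr_Suc_diff_le) auto
      then show "w (Suc t) - w t \<le> 6 * \<beta>0 * ?p powr \<delta>" by (simp add: w_def algebra_simps)
    qed
    have w_pos: "0 \<le> w t" using \<beta>0 by (simp add: w_def)
    have "w t * \<alpha> t = 4 * \<beta>0 * ?p powr \<delta> * (?p / (real t + 2))"
      by (simp add: w_eq \<alpha>_def \<beta>_def)
    also have "\<dots> \<le> 4 * \<beta>0 * ?p powr \<delta> * 1"
      using \<beta>0 by (intro mult_left_mono) auto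
    finally have w\<alpha>: "w t * \<alpha> t \<le> 4 * \<beta>0 * ?p powr \<delta>" by simp
    have "w t *\<^sub>R b t - w (Suc t) *\<^sub>R b (Suc t)
        = - (w t *\<^sub>R (b (Suc t) - b t)) - (w (Suc t) - w t) *\<^sub>R b (Suc t)"
      by (simp add: algebra_simps)
    then have "norm (w t *\<^sub>R b t - w (Suc t) *\<^sub>R b (Suc t))
        \<le> w t * norm (b (Suc t) - b t) + (w (Suc t) - w t) * norm (b (Suc t))"
      using w_pos w_diff(1) norm_triangle_ineq4[of "- (w t *\<^sub>R (b (Suc t) - b t))"
          "(w (Suc t) - w t) *\<^sub>R b (Suc t)"] by simp
    also have "\<dots> \<le> w t * (\<alpha> t * Kb) + (w (Suc t) - w t) * Kb"
      using w_pos w_diff(1) b b_diff by (intro add_mono mult_left_mono) auto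
    also have "\<dots> = (w t * \<alpha> t + (w (Suc t) - w t)) * Kb" by (simp add: algebra_simps)
    also have "\<dots> \<le> (10 * \<beta>0 * ?p powr \<delta>) * Kb"
      using K w\<alpha> w_diff(2) by (intro mult_right_mono) auto
    also have "\<dots> \<le> (10 * \<beta>0 * ?p powr q) * Kb"
      using K \<beta>0 q by (intro mult_right_mono mult_left_mono powr_mono) auto
    finally have nb: "norm (w t *\<^sub>R b t - w (Suc t) *\<^sub>R b (Suc t)) \<le> 10 * \<beta>0 * ?p powr q * Kb" .
    have "a (Suc t) \<bullet> (w t *\<^sub>R b t - w (Suc t) *\<^sub>R b (Suc t))
        \<le> norm (a (Suc t)) * norm (w t *\<^sub>R b t - w (Suc t) *\<^sub>R b (Suc t))"
      by (rule norm_cauchy_schwarz)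
    also have "\<dots> \<le> Ka * (10 * \<beta>0 * ?p powr q * Kb)"
      using K a nb by (intro mult_mono) auto
    finally have ab: "a (Suc t) \<bullet> (w t *\<^sub>R b t - w (Suc t) *\<^sub>R b (Suc t))
        \<le> Ka * (10 * \<beta>0 * ?p powr q * Kb)" .
    have "Z (Suc t) = (real t + 1) * (real t + 2) * \<Psi> (Suc t) - w (Suc t) * (a (Suc t) \<bullet> b (Suc t))"
      by (simp add: Z_def algebra_simps)
    \<comment> \<open>Abel's rearrangement: \<open>w t * (a (Suc t) \<bullet> b t)\<close> joins the
      new correction term, and \<open>- w t * (a t \<bullet> b t)\<close> is the correction already
      inside \<open>Z t\<close>.\<close>
    also have "\<dots> \<le> Z t + a (Suc t) \<bullet> (w t *\<^sub>R b t - w (Suc t) *\<^sub>R b (Suc t))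
        + 2 * E * ?p powr q"
      using \<Psi>_step[OF t] by (simp add: Z_def inner_diff_left inner_diff_right algebra_simps)
    finally show ?thesis using ab by (simp add: M_def algebra_simps)
  qed
  \<comment> \<open>\<open>N\<close> dominates both the starting value and each increment, so
    \<open>t\<close> summands of size at most \<open>N * (t + 1) powr q\<close> bound
    \<open>Z t\<close>.\<close>
  define N where "N = max M (Z 1)"
  have Z_le: "Z t \<le> N * real t * (real t + 1) powr q" if "1 \<le> t" for t
    using that
  proof (induction t rule: dec_induct)
    case base
    have "Z 1 \<le> N * 1" by (simp add: N_def)
    also have "\<dots> \<le> N * (2 powr q)"
      using M q by (intro mult_left_mono ge_one_powr_ge_zero) (auto simp: N_def)
    finally show ?case by simp
  next
    case (step t)
    have "Z (Suc t) \<le> N * real t * (real t + 1) powr q + M * (real t + 1) powr q"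
      using Z_step[of t] step by simp
    also have "\<dots> \<le> N * real t * (real t + 1) powr q + N * (real t + 1) powr q"
      by (intro add_mono mult_right_mono) (auto simp: N_def)
    also have "\<dots> = N * (real t + 1) * (real t + 1) powr q" by (simp add: algebra_simps)
    also have "\<dots> \<le> N * (real t + 1) * (real (Suc t) + 1) powr q"
      using M q by (intro mult_left_mono powr_mono2) (auto simp: N_def)
    finally show ?case by (simp add: add.commute)
  qed
  show thesis
  proof
    show "0 \<le> N + 4 * \<beta>0 * Ka * Kb" using M \<beta>0 K by (simp add: N_def max_def)
    fix t :: nat assume t: "1 \<le> t"
    let ?p = "real t + 1"
    have w: "0 \<le> w t" using \<beta>0 by (simp add: w_def)
    \<comment> \<open>Returning from \<open>Z\<close> to \<open>\<Psi>\<close> adds back the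
      correction. By \<open>\<delta> \<le> q\<close> it has the same order
      \<open>t * (t + 1) powr q\<close>, so dividing by \<open>t * (t + 1)\<close> gives the
      rate.\<close>
    have "w t \<le> 2 * \<beta>0 * (?p * ?p powr q)"
      unfolding w_def powr_mult_base[of ?p, simplified]
      using \<beta>0 q by (intro mult_left_mono powr_mono) auto
    also have "\<dots> \<le> 2 * \<beta>0 * ((2 * real t) * ?p powr q)"
      using \<beta>0 t by (intro mult_left_mono mult_right_mono) auto
    finally have w_le: "w t \<le> 4 * \<beta>0 * real t * ?p powr q" by simp
    have "a t \<bullet> b t \<le> norm (a t) * norm (b t)" by (rule norm_cauchy_schwarz)
    also have "\<dots> \<le> Ka * Kb" using a b K by (intro mult_mono) auto
    finally have "w t * (a t \<bullet> b t) \<le> w t * (Ka * Kb)" using w by (rule mult_left_mono)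
    also have "\<dots> \<le> (4 * \<beta>0 * real t * ?p powr q) * (Ka * Kb)"
      using w_le K by (intro mult_right_mono) auto
    finally have "w t * (a t \<bullet> b t) \<le> (4 * \<beta>0 * real t * ?p powr q) * (Ka * Kb)" .
    then have "real t * (?p * \<Psi> t) \<le> real t * ((N + 4 * \<beta>0 * Ka * Kb) * ?p powr q)"
      using Z_le[OF t] by (simp add: Z_def algebra_simps)
    then have "?p * \<Psi> t \<le> (N + 4 * \<beta>0 * Ka * Kb) * ?p powr q"
      using t by simp
    also have "?p powr q = ?p * ?p powr (- \<rho>)" by (simp add: powr_mult_base q_def)
    finally have "?p * \<Psi> t \<le> ?p * ((N + 4 * \<beta>0 * Ka * Kb) * ?p powr (- \<rho>))"
      by (simp add: mult_ac)
    then have \<Psi>: "\<Psi> t \<le> (N + 4 * \<beta>0 * Ka * Kb) * ?p powr (- \<rho>)"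
      by (rule mult_left_le_imp_le) simp
    \<comment> \<open>For \<open>t \<ge> 1\<close> one has \<open>(t + 1) / 2 \<le> t\<close>;
      passing from the lagged weight to \<open>(t + 1) powr \<delta>\<close> costs at most a factor
      2, hence \<open>\<beta>0 / 4\<close>.\<close>
    have "(1 / 2) * ?p powr \<delta> \<le> (1 / 2) powr \<delta> * ?p powr \<delta>"
      using powr_mono'[of \<delta> 1 "1/2::real"] \<delta> by (intro mult_right_mono) auto
    also have "\<dots> = (?p / 2) powr \<delta>" by (simp add: powr_divide)
    also have "\<dots> \<le> real t powr \<delta>" using t \<delta> by (intro powr_mono2) auto
    finally have "\<beta>0 / 4 * ?p powr \<delta> \<le> \<beta> (t - 1) / 2"
      using t \<beta>0 by (simp add: \<beta>_def of_nat_diff)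
    then have "\<beta>0 / 4 * ?p powr \<delta> * (n t)\<^sup>2 \<le> \<beta> (t - 1) / 2 * (n t)\<^sup>2"
      by (rule mult_right_mono) simp
    with \<Psi> show "G t + \<beta>0 / 4 * ?p powr \<delta> * (n t)\<^sup>2 \<le> (N + 4 * \<beta>0 * Ka * Kb) * ?p powr (- \<rho>)"
      unfolding \<Psi>_def by linarith
  qed
qed

text \<open>Combining the two bounds on \<open>G\<close> gives \<open>k * p powr \<delta> *
  n\<^sup>2 \<le> C * p powr (- \<rho>) + K * n\<close>. If the linear term dominates,
  \<open>n\<close> has order \<open>p powr (- \<delta>)\<close>; otherwise a square root gives
  exponent \<open>(\<rho> + \<delta>) / 2\<close>. The bound on \<open>n\<close> then controls
  \<open>G\<close> from below.\<close>

lemma quadratic_penalty_rates: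
  fixes G n p k K C \<delta> \<rho> \<sigma> :: real
  assumes p: "1 \<le> p" and k: "0 < k" and K: "0 \<le> K" and C: "0 \<le> C" and n: "0 \<le> n"
    and upper: "G + k * p powr \<delta> * n\<^sup>2 \<le> C * p powr (- \<rho>)" and lower: "- K * n \<le> G"
    and \<sigma>: "\<sigma> \<le> \<delta>" "\<sigma> \<le> (\<rho> + \<delta>) / 2"
  shows "n \<le> (2 * K / k + sqrt (2 * C / k)) * p powr (- \<sigma>)"
    and "\<bar>G\<bar> \<le> (C + K * (2 * K / k + sqrt (2 * C / k))) * p powr (- min \<rho> \<sigma>)"
proof -
  let ?L = "2 * K / k + sqrt (2 * C / k)"
  show n_le: "n \<le> ?L * p powr (- \<sigma>)"
  proof (cases "C * p powr (- \<rho>) \<le> K * n")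
    case True
    have "n * (k * p powr \<delta> * n) \<le> n * (2 * K)"
      using upper lower True by (simp add: power2_eq_square algebra_simps)
    then have "n = 0 \<or> k * p powr \<delta> * n \<le> 2 * K" using n by (auto simp: mult_le_cancel_left)
    then have "k * p powr \<delta> * n \<le> 2 * K" using K by auto
    then have "n \<le> 2 * K / k * p powr (- \<delta>)"
      using k p by (simp add: powr_minus field_simps)
    also have "\<dots> \<le> 2 * K / k * p powr (- \<sigma>)"
      using K k p \<sigma> by (intro mult_left_mono powr_mono) auto
    also have "\<dots> \<le> ?L * p powr (- \<sigma>)"
      using k C by (intro mult_right_mono) auto
    finally show ?thesis .
  next
    case False
    have "k * p powr \<delta> * n\<^sup>2 \<le> 2 * C * p powr (- \<rho>)" using upper lower False by simp
    then have "n\<^sup>2 \<le> 2 * C / k * (p powr (- \<rho>) * p powr (- \<delta>))"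
      using k p by (simp add: powr_minus field_simps)
    also have "\<dots> \<le> 2 * C / k * (p powr (- \<sigma>) * p powr (- \<sigma>))"
      unfolding powr_add[symmetric] using p \<sigma> k C by (intro mult_left_mono powr_mono) auto
    finally have "n\<^sup>2 \<le> 2 * C / k * (p powr (- \<sigma>))\<^sup>2"
      by (simp add: power2_eq_square)
    then have "n \<le> sqrt (2 * C / k * (p powr (- \<sigma>))\<^sup>2)" by (rule real_le_rsqrt)
    also have "\<dots> = sqrt (2 * C / k) * p powr (- \<sigma>)"
      by (simp only: real_sqrt_mult real_sqrt_abs) simp
    also have "\<dots> \<le> ?L * p powr (- \<sigma>)" using K k by (intro mult_right_mono) auto
    finally show ?thesis .
  qed
  have L: "0 \<le> ?L" using K k C by simp
  have "C * p powr (- \<rho>) \<le> C * p powr (- min \<rho> \<sigma>)"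
    using C p by (intro mult_left_mono powr_mono) auto
  moreover have "0 \<le> k * p powr \<delta> * n\<^sup>2" using k by simp
  moreover have "K * n \<le> K * ?L * p powr (- min \<rho> \<sigma>)"
  proof -
    have "K * n \<le> K * (?L * p powr (- \<sigma>))" using n_le K by (intro mult_left_mono)
    also have "\<dots> \<le> K * (?L * p powr (- min \<rho> \<sigma>))"
      using K L p by (intro mult_left_mono powr_mono) auto
    finally show ?thesis by simp
  qed
  moreover have "0 \<le> C * p powr (- min \<rho> \<sigma>)" "0 \<le> K * n" using C K n by simp_all
  ultimately have "G \<le> C * p powr (- min \<rho> \<sigma>) + K * ?L * p powr (- min \<rho> \<sigma>)"
    "- G \<le> C * p powr (- min \<rho> \<sigma>) + K * ?L * p powr (- min \<rho> \<sigma>)"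
    using upper lower by linarith+
  then show "\<bar>G\<bar> \<le> (C + K * ?L) * p powr (- min \<rho> \<sigma>)" by (simp add: distrib_right)
qed

section \<open>Powers of the step size compared with powers of \<open>t + 1\<close>\<close>

lemma step_size_sq_mult_powr_le:
  fixes s r k :: real
  assumes "0 \<le> s" "r - 2 \<le> k"
  shows "(s + 1) powr r * (2 / (s + 2))\<^sup>2 \<le> 4 * (s + 1) powr k"
proof -
  have "(2 / (s + 2))\<^sup>2 \<le> (2 / (s + 1))\<^sup>2"
    using assms by (intro power_mono divide_left_mono) auto
  also have "\<dots> = 4 * (s + 1) powr (- 2)"
    using assms by (simp add: power_divide powr_minus_divide)
  finally have "(s + 1) powr r * (2 / (s + 2))\<^sup>2 \<le> (s + 1) powr r * (4 * (s + 1) powr (- 2))"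
    by (rule mult_left_mono) simp
  also have "\<dots> = 4 * (s + 1) powr (r - 2)" by (simp add: powr_add[symmetric])
  also have "\<dots> \<le> 4 * (s + 1) powr k" using assms by (intro mult_left_mono powr_mono) auto
  finally show ?thesis .
qed

lemma step_size_powr_le:
  fixes s r k :: real
  assumes "0 \<le> s" "0 \<le> r" "r \<le> 2" "- r \<le> k"
  shows "(2 / (s + 2)) powr r \<le> 4 * (s + 1) powr k"
proof -
  have "(2 / (s + 2)) powr r \<le> (2 / (s + 1)) powr r"
    using assms by (intro powr_mono2 divide_left_mono) auto
  also have "\<dots> = 2 powr r * (s + 1) powr (- r)"
    using assms by (simp add: powr_divide powr_minus_divide)
  also have "\<dots> \<le> 2 powr 2 * (s + 1) powr k"
    using assms by (intro mult_mono powr_mono) auto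
  finally show ?thesis by simp
qed

text \<open>The Hoelder remainder comes with base \<open>t\<close>, while the recursion is stated
  with base \<open>t + 1\<close>; for \<open>s \<ge> 1\<close> the two bases differ by at most a
  factor 2, which \<open>r \<le> 2\<close> turns into the constant 4.\<close>

lemma powr_minus_le_shift:
  fixes s r k :: real
  assumes "1 \<le> s" "0 \<le> r" "r \<le> 2" "- r \<le> k"
  shows "s powr (- r) \<le> 4 * (s + 1) powr k"
proof -
  have "s powr (- r) \<le> ((s + 1) / 2) powr (- r)"
    using assms by (intro powr_mono2') auto
  also have "\<dots> = 2 powr r * (s + 1) powr (- r)"
    using assms by (simp add: powr_divide powr_minus_divide)
  also have "\<dots> \<le> 2 powr 2 * (s + 1) powr k"
    using assms by (intro mult_mono powr_mono) auto
  finally show ?thesis by simp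
qed

text \<open>Each summand is a constant times a power below the maximum \<open>m\<close>; since
  \<open>\<mu> \<le> 1\<close>, both \<open>1 / (t + 1)\<close> and \<open>1 / (t * (t + 1))\<close>
  are below \<open>(t + 1) powr (- \<mu>)\<close>. The bounding constant covers both branches of the
  conditional at once.\<close>

lemma tau_bigo:
  fixes \<tau> :: "nat \<Rightarrow> real" and \<delta> \<mu> \<nu> w1 w2 w3 w4 w5 :: real
  assumes \<mu>: "\<mu> \<le> 1"
    and \<tau>: "\<And>t. 2 \<le> t \<Longrightarrow> \<tau> t =
           w1 / (real t * (real t + 1)) + w2 / (real t + 1) powr (1 - \<delta>)
           + w3 / (real t + 1) powr \<nu>
           + (if \<mu> < 1 then w4 / (real t + 1) powr \<mu> else w5 / (real t + 1))"
  shows "\<tau> \<in> O(\<lambda>t. Max {(real t + 1) powr (-(1 - \<delta>)), (real t + 1) powr (-\<nu>),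
                          (real t + 1) powr (-\<mu>)})"
proof (rule bigoI)
  show "\<forall>\<^sub>F t in sequentially. norm (\<tau> t) \<le> (\<bar>w1\<bar> + \<bar>w2\<bar> + \<bar>w3\<bar> + \<bar>w4\<bar> + \<bar>w5\<bar>) *
      norm (Max {(real t + 1) powr (-(1 - \<delta>)), (real t + 1) powr (-\<nu>), (real t + 1) powr (-\<mu>)})"
    using eventually_ge_at_top[of 2]
  proof eventually_elim
    case (elim t)
    let ?p = "real t + 1"
    define m where "m = Max {?p powr (-(1 - \<delta>)), ?p powr (-\<nu>), ?p powr (-\<mu>)}"
    have m: "?p powr (-(1 - \<delta>)) \<le> m" "?p powr (-\<nu>) \<le> m" "?p powr (-\<mu>) \<le> m"
      by (auto simp: m_def)
    have m0: "0 \<le> m" using m(3) powr_ge_zero order_trans by blast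
    have "?p powr (- 1) \<le> ?p powr (-\<mu>)" using \<mu> by (intro powr_mono) auto
    then have inv: "1 / ?p \<le> m" using m(3) by (simp add: powr_minus_divide)
    have "1 / (real t * ?p) \<le> 1 / ?p" using elim by (intro divide_left_mono) auto
    then have inv2: "1 / (real t * ?p) \<le> m" using inv by simp
    have le: "\<bar>w * r\<bar> \<le> \<bar>w\<bar> * m" if "0 \<le> r" "r \<le> m" for w r
      using that by (simp add: abs_mult mult_left_mono)
    have sum_le: "\<bar>a + b + c + (if P then d else e)\<bar> \<le> a' + b' + c' + d' + e'"
      if "\<bar>a\<bar> \<le> a'" "\<bar>b\<bar> \<le> b'" "\<bar>c\<bar> \<le> c'" "\<bar>d\<bar> \<le> d'" "\<bar>e\<bar> \<le> e'"
      for a b c d e a' b' c' d' e' :: real and P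
      using that by (auto simp: abs_le_iff)
    have "\<bar>w1 * (1 / (real t * ?p))\<bar> \<le> \<bar>w1\<bar> * m" "\<bar>w2 * ?p powr (-(1 - \<delta>))\<bar> \<le> \<bar>w2\<bar> * m"
      "\<bar>w3 * ?p powr (-\<nu>)\<bar> \<le> \<bar>w3\<bar> * m" "\<bar>w4 * ?p powr (-\<mu>)\<bar> \<le> \<bar>w4\<bar> * m"
      "\<bar>w5 * (1 / ?p)\<bar> \<le> \<bar>w5\<bar> * m"
      using m inv inv2 by (intro le; simp)+
    moreover have "\<tau> t = w1 * (1 / (real t * ?p)) + w2 * ?p powr (-(1 - \<delta>)) + w3 * ?p powr (-\<nu>)
        + (if \<mu> < 1 then w4 * ?p powr (-\<mu>) else w5 * (1 / ?p))"
      unfolding \<tau>[OF elim] powr_minus_divide by simp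
    ultimately have "\<bar>\<tau> t\<bar> \<le> \<bar>w1\<bar> * m + \<bar>w2\<bar> * m + \<bar>w3\<bar> * m + \<bar>w4\<bar> * m + \<bar>w5\<bar> * m"
      by (simp only: sum_le)
    also have "\<dots> = (\<bar>w1\<bar> + \<bar>w2\<bar> + \<bar>w3\<bar> + \<bar>w4\<bar> + \<bar>w5\<bar>) * norm m"
      using m0 by (simp add: algebra_simps)
    finally show ?case by (simp only: m_def real_norm_def)
  qed
qed

section \<open>Verification of the recursion for the iterates, and the resulting rates\<close>

theorem mainTheorem2:
  fixes f f2 :: "'a::euclidean_space \<Rightarrow> ereal" and g g2 :: "'b::euclidean_space \<Rightarrow> ereal"
    and f1 :: "'a \<Rightarrow> real" and g1 :: "'b \<Rightarrow> real"
    and gradf1 :: "'a \<Rightarrow> 'a" and gradg1 :: "'b \<Rightarrow> 'b"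
    and A :: "'a \<Rightarrow> 'c::euclidean_space" and B :: "'b \<Rightarrow> 'c" and c :: 'c
    and \<mu> \<nu> Mf Mg \<beta>0 H0 \<delta> lamA lamB Df Dg D2 :: real
    and xs :: 'a and ys :: 'b
    and x :: "nat \<Rightarrow> 'a" and y u :: "nat \<Rightarrow> 'b" and R Rt :: "nat \<Rightarrow> 'c"
    and \<alpha> \<beta> H \<tau> :: "nat \<Rightarrow> real"
    and \<omega>0 \<omega>1 \<omega>2 \<omega>3 \<omega>4 \<omega>5 Ht0 \<theta> \<rho>1 \<rho>2 :: real
  \<comment> \<open>the problem\<close>
  assumes "linear A" and "linear B"
    and "proper_closed_convex f" and "proper_closed_convex g"
    and "is_solution f g A B c xs ys"
  \<comment> \<open>CQ\<close>
    and "c \<in> {A v + B w | v w. v \<in> rel_interior (edom f) \<and> w \<in> rel_interior (edom g)}"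
  \<comment> \<open>(D)\<close>
    and "edom_diam f < \<infinity>" and "edom_diam g < \<infinity>"
  \<comment> \<open>(S)\<close>
    and "\<And>z. f z = ereal (f1 z) + f2 z" and "\<And>z. g z = ereal (g1 z) + g2 z"
    and "convex_smooth f1 gradf1" and "convex_smooth g1 gradg1"
    and "proper_closed_convex f2" and "proper_closed_convex g2"
    and "hoelder_continuous_on (edom f) gradf1" and "hoelder_continuous_on (edom g) gradg1"
    and "0 < \<mu>" and "\<mu> \<le> 1" and "0 < \<nu>" and "\<nu> \<le> 1" and "0 \<le> Mf" and "0 \<le> Mg"
    and "\<And>v w. v \<in> edom f \<Longrightarrow> w \<in> edom f \<Longrightarrow>
           f1 w \<le> f1 v + gradf1 v \<bullet> (w - v) + Mf / (\<mu> + 1) * norm (w - v) powr (\<mu> + 1)"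
    and "\<And>v w. v \<in> edom g \<Longrightarrow> w \<in> edom g \<Longrightarrow>
           g1 w \<le> g1 v + gradg1 v \<bullet> (w - v) + Mg / (\<nu> + 1) * norm (w - v) powr (\<nu> + 1)"
    and "\<And>v. \<exists>z. is_arg_min (\<lambda>z. ereal (v \<bullet> z) + g2 z) (\<lambda>_. True) z"
  \<comment> \<open>the algorithm\<close>
    and "x 0 \<in> edom f" and "y 0 \<in> edom g"
    and "0 < \<beta>0" and "0 < H0" and "0 < \<delta>" and "\<delta> < 1"
    and "lamA = lambda_max (adjoint A \<circ> A)"
    and "\<And>t. \<alpha> t = 2 / (real t + 2)"
    and "\<beta> 0 = \<beta>0" and "\<And>t. \<beta> (Suc t) = \<beta>0 * (real t + 2) powr \<delta>"
    and "H 0 = H0"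
    and "\<And>t. H (Suc t) = max H0 (2 * Mf / (\<mu> + 1)) * (real t + 1) powr (1 - \<mu>)"
    and "\<And>t. R t = A (x t) + B (y t) - c"
    and "\<And>t. is_arg_min
           (\<lambda>z. ereal ((gradf1 (x t) + \<beta> t *\<^sub>R adjoint A (R t)) \<bullet> (z - x t)
                  + (H t + lamA * \<beta> t) / 2 * (norm (z - x t))\<^sup>2) + f2 z)
           (\<lambda>_. True) (x (Suc t))"
    and "\<And>t. Rt t = A (x (Suc t)) + B (y t) - c"
    and "\<And>t. is_arg_min
           (\<lambda>z. ereal ((gradg1 (y t) + \<beta> t *\<^sub>R adjoint B (Rt t)) \<bullet> z) + g2 z)
           (\<lambda>_. True) (u t)"
    and "\<And>t. y (Suc t) = y t + \<alpha> t *\<^sub>R (u t - y t)"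
  \<comment> \<open>the definition of \<open>\<tau>\<close>\<close>
    and "lamB = lambda_max (adjoint B \<circ> B)"
    and "Df = real_of_ereal (edom_diam f)" and "Dg = real_of_ereal (edom_diam g)"
    and "D2 = (SUP (v, w) \<in> edom f \<times> edom g. \<bar>A v \<bullet> B w\<bar>)"
    and "\<theta> = 2 * (real_of_ereal (f (x 1)) + real_of_ereal (g (y 1))
               + \<beta>0 / 2 * (norm (A (x 1) + B (y 1) - c))\<^sup>2
               - real_of_ereal (f xs) - real_of_ereal (g ys))"
    and "Ht0 = max H0 (2 * Mf / (\<mu> + 1))"
    and "\<omega>0 = 4 * Ht0 * (2 * Mf / ((1 + \<mu>) * Ht0)) powr (2 / (1 - \<mu>))"
    and "\<omega>1 = 2 powr (\<delta> + 3) * \<beta>0 * D2 + \<theta>"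
    and "\<omega>2 = 2 * lamA * Df\<^sup>2 * \<beta>0 + 2 * lamB * Dg\<^sup>2 * \<beta>0
               + (32 + 16 * \<delta>) / (1 + \<delta>) * D2 * \<beta>0"
    and "\<omega>3 = 2 powr (\<nu> + 1) / (\<nu> + 1) * Mg * Dg powr (\<nu> + 1)"
    and "\<omega>4 = 2 * Ht0 * Df\<^sup>2 + 2 * \<omega>0"
    and "\<omega>5 = 2 * Ht0 * Df\<^sup>2"
    and "\<And>t. 2 \<le> t \<Longrightarrow> \<tau> t =
           \<omega>1 / (real t * (real t + 1)) + \<omega>2 / (real t + 1) powr (1 - \<delta>)
           + \<omega>3 / (real t + 1) powr \<nu>
           + (if \<mu> < 1 then \<omega>4 / (real t + 1) powr \<mu> else \<omega>5 / (real t + 1))"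
  \<comment> \<open>the rates\<close>
    and "\<rho>1 = Min {1 - \<delta>, \<nu>, \<mu>}"
    and "\<rho>2 = Min {\<delta>, 1 / 2, (\<nu> + \<delta>) / 2, (\<mu> + \<delta>) / 2}"
  shows "\<tau> \<in> O(\<lambda>t. Max {(real t + 1) powr (-(1 - \<delta>)), (real t + 1) powr (-\<nu>),
                          (real t + 1) powr (-\<mu>)})
    \<and> (\<lambda>t. \<bar>real_of_ereal (f (x t)) + real_of_ereal (g (y t))
              - real_of_ereal (f xs) - real_of_ereal (g ys)\<bar>)
        \<in> O(\<lambda>t. (real t + 1) powr (- min \<rho>1 \<rho>2))
    \<and> (\<lambda>t. norm (A (x t) + B (y t) - c)) \<in> O(\<lambda>t. (real t + 1) powr (-\<rho>2))"
proof (intro conjI)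
  note lin = assms(1,2) and pcc = assms(3,4) and sol = assms(5)
    and f_eq = assms(9) and g_eq = assms(10) and smooth = assms(11,12) and pcc2 = assms(13,14)
    and exps = assms(17-20) and M = assms(21,22) and pos = assms(28-31)
  have X2: "edom f2 = edom f" and Y2: "edom g2 = edom g"
    using f_eq g_eq by (auto simp: edom_def)
  define fr where "fr z = real_of_ereal (f z)" for z
  define gr where "gr z = real_of_ereal (g z)" for z
  define f2r where "f2r z = real_of_ereal (f2 z)" for z
  define g2r where "g2r z = real_of_ereal (g2 z)" for z
  have fr: "fr z = f1 z + f2r z" if "z \<in> edom f" for z
    using that pcc2(1) by (cases "f2 z") (auto simp: fr_def f2r_def f_eq edom_def proper_closed_convex_def)
  have gr: "gr z = g1 z + g2r z" if "z \<in> edom g" for z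
    using that pcc2(2) by (cases "g2 z") (auto simp: gr_def g2r_def g_eq edom_def proper_closed_convex_def)
  have conv: "convex_on (edom f) fr" "convex_on (edom g) gr"
    and conv2: "convex_on (edom f) f2r" "convex_on (edom g) g2r"
    using pcc pcc2 proper_closed_convex_convex_on X2 Y2
    unfolding fr_def gr_def f2r_def g2r_def by metis+
  obtain v0 w0 where v0: "v0 \<in> rel_interior (edom f)" "w0 \<in> rel_interior (edom g)" "A v0 + B w0 = c"
    using assms(6) by blast
  have ne: "f z \<noteq> -\<infinity>" "g z' \<noteq> -\<infinity>" for z z'
    using pcc by (auto simp: proper_closed_convex_def)
  have s: "xs \<in> edom f" "ys \<in> edom g"
  proof -
    have "\<exists>x\<in>edom f. \<exists>y\<in>edom g. A x + B y = c" 
      using v0 subsetD[OF rel_interior_subset v0(1)] subsetD[OF rel_interior_subset v0(2)] by blast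
    from solution_in_edom[OF ne this sol] show "xs \<in> edom f" "ys \<in> edom g" by simp_all
  qed
  have feas: "A xs + B ys = c" using sol by (simp add: is_solution_def is_arg_min_def)
  have opt: "fr xs + gr ys \<le> fr v + gr w" if "v \<in> edom f" "w \<in> edom g" "A v + B w = c" for v w
  proof -
    have "f xs + g ys \<le> f v + g w"
      using sol that(3) unfolding is_solution_def is_arg_min_def by (auto simp: not_less)
    then show ?thesis using ne(1)[of xs] ne(2)[of ys] ne(1)[of v] ne(2)[of w] s that
      by (cases "f xs"; cases "g ys"; cases "f v"; cases "g w")
        (auto simp: fr_def gr_def edom_def)
  qed
  \<comment> \<open>The exact penalty bound is applied on the product of the two domains, whose
    relative interior is the product of the relative interiors; the constraint qualification
    supplies the point \<open>(v0, w0)\<close> there.\<close>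
  obtain K where K: "0 \<le> K"
    and lower: "\<And>v w. v \<in> edom f \<Longrightarrow> w \<in> edom g \<Longrightarrow>
      fr xs + gr ys - K * norm (A v + B w - c) \<le> fr v + gr w"
  proof -
    have 1: "linear (\<lambda>z. A (fst z) + B (snd z))"
      using lin by (intro linearI) (auto simp: linear_add linear_cmul algebra_simps)
    have 2: "convex_on (edom f \<times> edom g) (\<lambda>z. fr (fst z) + gr (snd z))"
    proof (rule convex_onI)
      show "convex (edom f \<times> edom g)"
        using conv by (intro convex_Times) (auto dest: convex_on_imp_convex)
      fix t :: real and z z' assume t: "0 < t" "t < 1"
        and z: "z \<in> edom f \<times> edom g" "z' \<in> edom f \<times> edom g"
      have "fr ((1 - t) *\<^sub>R fst z + t *\<^sub>R fst z') \<le> (1 - t) * fr (fst z) + t * fr (fst z')"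
        "gr ((1 - t) *\<^sub>R snd z + t *\<^sub>R snd z') \<le> (1 - t) * gr (snd z) + t * gr (snd z')"
        using convex_onD[OF conv(1), of t] convex_onD[OF conv(2), of t] t z by auto
      then show "fr (fst ((1 - t) *\<^sub>R z + t *\<^sub>R z')) + gr (snd ((1 - t) *\<^sub>R z + t *\<^sub>R z'))
          \<le> (1 - t) * (fr (fst z) + gr (snd z)) + t * (fr (fst z') + gr (snd z'))"
        by (simp add: algebra_simps)
    qed
    have 3: "(v0, w0) \<in> rel_interior (edom f \<times> edom g)"
      using conv v0 by (simp add: rel_interior_Times convex_on_imp_convex)
    show thesis
      by (rule convex_program_exact_penalty[OF 1 2 3, of c "(xs, ys)"])
        (use v0 s feas opt that in auto)
  qed
  have x: "x t \<in> edom f" for t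
    by (rule prox_iterates_in_edom[OF pcc2(1) f_eq assms(26) assms(39)])
  have y: "y t \<in> edom g" for t
    by (rule cond_grad_iterates_in_edom[where y = y and u = u,
          OF pcc2(2) g_eq assms(27) assms(41) assms(42)[unfolded assms(33)]])
  have u: "u t \<in> edom g" for t
    using arg_min_in_edom[OF _ _ assms(41)[of t]] pcc2(2) Y2 by (auto simp: proper_closed_convex_def)
  obtain D1 where D1: "0 \<le> D1" "\<And>v w. v \<in> edom f \<Longrightarrow> w \<in> edom f \<Longrightarrow> norm (v - w) \<le> D1"
    using bounded_edom[OF assms(7)] by blast
  \<comment> \<open>From here on \<open>D2\<close> bounds the diameter of \<open>edom g\<close>; it
    hides the supremum of inner products of the same name in the statement.\<close>
  obtain D2 where D2: "0 \<le> D2" "\<And>v w. v \<in> edom g \<Longrightarrow> w \<in> edom g \<Longrightarrow> norm (v - w) \<le> D2"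
    using bounded_edom[OF assms(8)] by blast
  obtain kA where kA: "0 < kA" "\<And>z. norm (A z) \<le> kA * norm z"
    using linear_bounded_pos[OF lin(1)] by blast
  obtain kB where kB: "0 < kB" "\<And>z. norm (B z) \<le> kB * norm z"
    using linear_bounded_pos[OF lin(2)] by blast
  have lamA: "(norm (A d))\<^sup>2 \<le> lamA * (norm d)\<^sup>2" for d
    unfolding assms(32) by (rule norm_sq_le_lambda_max[OF lin(1)])
  obtain e where "e \<in> (Basis :: 'a set)" using nonempty_Basis by blast
  then have lamA0: "0 \<le> lamA" using order_trans[OF zero_le_power2 lamA[of e]] by simp
  have \<beta>: "\<beta> t = \<beta>0 * (real t + 1) powr \<delta>" for t
    using assms(34,35) by (cases t) (auto simp: add.commute)
  have \<alpha>: "\<alpha> t = 2 / (real t + 2)" for t by (rule assms(33))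
  \<comment> \<open>The entry \<open>1 / 2\<close> of \<open>\<rho>2\<close> is
    \<open>((1 - \<delta>) + \<delta>) / 2\<close>, so the last three entries combine to
    \<open>(\<rho>1 + \<delta>) / 2\<close>.\<close>
  have \<rho>1: "\<rho>1 \<le> 1 - \<delta>" "\<rho>1 \<le> \<nu>" "\<rho>1 \<le> \<mu>" and \<rho>2: "\<rho>2 = min \<delta> ((\<rho>1 + \<delta>) / 2)"
    unfolding assms(56,57) by (auto simp: min_def field_simps)
  define G where "G t = fr (x t) + gr (y t) - (fr xs + gr ys)" for t
  define m where "m = Mf / (\<mu> + 1)"
  have m: "0 \<le> m" "2 * m \<le> Ht0" using M exps by (auto simp: m_def assms(48))
  have Ht0: "0 < Ht0" using pos by (simp add: assms(48))
  define Ka where "Ka = kA * (norm xs + D1)"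
  define Kb where "Kb = kB * D2"
  \<comment> \<open>The summands are, in order, the proximal cost, the Hoelder remainders of
    \<open>f1\<close> and \<open>g1\<close>, and the penalty curvature of the conditional gradient
    step.\<close>
  define E where "E = 2 * (Ht0 + lamA * \<beta>0) * D1\<^sup>2 + 4 * m + 4 * (Mg / (\<nu> + 1)) * D2 powr (\<nu> + 1)
    + 2 * \<beta>0 * Kb\<^sup>2"
  have E: "0 \<le> E" using m Ht0 lamA0 M exps pos by (simp add: E_def)
  have norm_B: "norm (B (v - w)) \<le> Kb" if "v \<in> edom g" "w \<in> edom g" for v w
    using kB D2(2)[OF that] by (auto simp: Kb_def intro: order_trans[OF kB(2)])
  have step: "G (Suc t) + \<beta> t / 2 * (norm (R (Suc t)))\<^sup>2
      \<le> (1 - \<alpha> t) * G t + (1 / 2 - \<alpha> t) * \<beta> t * (norm (R t))\<^sup>2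
        + \<alpha> t * \<beta> t * ((A (x (Suc t)) - A (x t)) \<bullet> B (ys - y t))
        + E * (real t + 1) powr (- 1 - \<rho>1)" if t: "1 \<le> t" for t
  proof -
    let ?P = "(real t + 1) powr (- 1 - \<rho>1)"
    have \<alpha>01: "0 \<le> \<alpha> t" "\<alpha> t \<le> 1" by (auto simp: \<alpha>)
    have \<beta>pos: "0 \<le> \<beta> t" using pos by (simp add: \<beta>)
    have Rt: "R t + A (x (Suc t) - x t) = Rt t" "Rt t + B (y (Suc t) - y t) = R (Suc t)"
      by (simp_all add: assms(38,40) linear_diff[OF lin(1)] linear_diff[OF lin(2)])
    \<comment> \<open>The formula relies on \<open>t \<ge> 1\<close>, since \<open>H 0\<close> is
      set separately; this is why the recursion starts at index 1.\<close>
    have Ht: "H t = Ht0 * real t powr (1 - \<mu>)" using t assms(37)[of "t - 1"] by (simp add: assms(48) of_nat_diff)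
    have xstep: "f1 (x (Suc t)) + f2r (x (Suc t)) + \<beta> t / 2 * (norm (Rt t))\<^sup>2
        \<le> (1 - \<alpha> t) * (f1 (x t) + f2r (x t)) + \<alpha> t * (f1 xs + f2r xs) + \<beta> t / 2 * (norm (R t))\<^sup>2
          + \<alpha> t * \<beta> t * (R t \<bullet> A (xs - x t))
          + (H t + lamA * \<beta> t) / 2 * (\<alpha> t)\<^sup>2 * (norm (xs - x t))\<^sup>2
          + (m * norm (x (Suc t) - x t) powr (\<mu> + 1) - H t / 2 * (norm (x (Suc t) - x t))\<^sup>2)"
      unfolding Rt(1)[symmetric]
    proof (rule proximal_gradient_step_le[OF lin(1) conv2(1) x s(1) \<alpha>01 \<beta>pos lamA])
      show "f1 (x (Suc t)) \<le> f1 (x t) + gradf1 (x t) \<bullet> (x (Suc t) - x t)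
          + m * norm (x (Suc t) - x t) powr (\<mu> + 1)"
        unfolding m_def by (rule assms(23)[OF x x])
      show "f1 (x t) + gradf1 (x t) \<bullet> (xs - x t) \<le> f1 xs"
        by (rule convex_smooth_tangent_le[OF smooth(1)])
    qed (use is_arg_min_edom_le[OF pcc2(1) assms(39)[of t]] in \<open>simp add: X2 f2r_def\<close>)
    have ystep: "g1 (y (Suc t)) + g2r (y (Suc t)) + \<beta> t / 2 * (norm (R (Suc t)))\<^sup>2
        \<le> (1 - \<alpha> t) * (g1 (y t) + g2r (y t)) + \<alpha> t * (g1 ys + g2r ys) + \<beta> t / 2 * (norm (Rt t))\<^sup>2
          + \<alpha> t * \<beta> t * (Rt t \<bullet> B (ys - y t)) + \<beta> t / 2 * (\<alpha> t)\<^sup>2 * (norm (B (u t - y t)))\<^sup>2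
          + Mg / (\<nu> + 1) * norm (y (Suc t) - y t) powr (\<nu> + 1)"
      unfolding Rt(2)[symmetric]
    proof (rule conditional_gradient_step_le[OF lin(2) conv2(2) y u s(2) \<alpha>01])
      show "y (Suc t) = y t + \<alpha> t *\<^sub>R (u t - y t)" by (rule assms(42))
      show "g1 (y (Suc t)) \<le> g1 (y t) + gradg1 (y t) \<bullet> (y (Suc t) - y t)
          + Mg / (\<nu> + 1) * norm (y (Suc t) - y t) powr (\<nu> + 1)"
        by (rule assms(24)[OF y y])
      show "g1 (y t) + gradg1 (y t) \<bullet> (ys - y t) \<le> g1 ys"
        by (rule convex_smooth_tangent_le[OF smooth(2)])
    qed (use is_arg_min_edom_le[OF pcc2(2) assms(41)[of t]] s in \<open>simp add: Y2 g2r_def\<close>)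
    \<comment> \<open>Feasibility gives \<open>A (xs - x t) + B (ys - y t) = - R t\<close>, which
      produces the helpful square. Evaluating the second step at \<open>Rt t\<close> instead of
      \<open>R t\<close> leaves the product term.\<close>
    have cross: "R t \<bullet> A (xs - x t) + Rt t \<bullet> B (ys - y t)
        = (A (x (Suc t)) - A (x t)) \<bullet> B (ys - y t) - (norm (R t))\<^sup>2"
    proof -
      have "A (xs - x t) + B (ys - y t) = - R t"
        using feas by (simp add: assms(38) linear_diff[OF lin(1)] linear_diff[OF lin(2)] algebra_simps)
      then have "R t \<bullet> A (xs - x t) + R t \<bullet> B (ys - y t) = - (norm (R t))\<^sup>2"
        by (simp add: inner_add_right[symmetric] power2_norm_eq_inner)
      moreover have "Rt t = R t + (A (x (Suc t)) - A (x t))" by (simp add: assms(38,40))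
      ultimately show ?thesis by (simp add: inner_add_left)
    qed
    \<comment> \<open>Here the growth of \<open>H\<close> is used: \<open>2 * m \<le> Ht0\<close>
      makes the remaining quadratic term strong enough to absorb the Hoelder term.\<close>
    have "m * norm (x (Suc t) - x t) powr (\<mu> + 1) - H t / 2 * (norm (x (Suc t) - x t))\<^sup>2
        \<le> m * real t powr (- (1 + \<mu>))"
      using exps m t by (intro hoelder_term_le) (auto simp: Ht mult_right_mono)
    also have "\<dots> \<le> m * (4 * ?P)"
      using m t exps \<rho>1 by (intro mult_left_mono powr_minus_le_shift) auto
    finally have e1: "m * norm (x (Suc t) - x t) powr (\<mu> + 1) - H t / 2 * (norm (x (Suc t) - x t))\<^sup>2
        \<le> 4 * m * ?P" by simp
    \<comment> \<open>The exponents \<open>1 - \<mu> - 2\<close>, \<open>\<delta> - 2\<close> and,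
      further below, \<open>- (\<nu> + 1)\<close> are all at most \<open>- 1 - \<rho>1\<close>, one
      for each entry of the minimum \<open>\<rho>1\<close>.\<close>
    have "real t powr (1 - \<mu>) * (\<alpha> t)\<^sup>2 \<le> (real t + 1) powr (1 - \<mu>) * (\<alpha> t)\<^sup>2"
      using exps by (intro mult_right_mono powr_mono2) auto
    also have "\<dots> \<le> 4 * ?P" unfolding \<alpha> using \<rho>1 by (intro step_size_sq_mult_powr_le) auto
    finally have H\<alpha>: "H t * (\<alpha> t)\<^sup>2 \<le> Ht0 * (4 * ?P)"
      using Ht0 by (simp add: Ht)
    have "(real t + 1) powr \<delta> * (\<alpha> t)\<^sup>2 \<le> 4 * ?P"
      unfolding \<alpha> using \<rho>1 by (intro step_size_sq_mult_powr_le) auto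
    then have \<beta>\<alpha>: "\<beta> t * (\<alpha> t)\<^sup>2 \<le> \<beta>0 * (4 * ?P)" using pos by (simp add: \<beta>)
    have "(H t + lamA * \<beta> t) / 2 * (\<alpha> t)\<^sup>2 = (H t * (\<alpha> t)\<^sup>2 + lamA * (\<beta> t * (\<alpha> t)\<^sup>2)) / 2"
      by (simp add: algebra_simps)
    also have "\<dots> \<le> (Ht0 * (4 * ?P) + lamA * (\<beta>0 * (4 * ?P))) / 2"
      using H\<alpha> \<beta>\<alpha> lamA0 by (intro divide_right_mono add_mono mult_left_mono) auto
    also have "\<dots> = 2 * (Ht0 + lamA * \<beta>0) * ?P" by (simp add: algebra_simps)
    finally have "(H t + lamA * \<beta> t) / 2 * (\<alpha> t)\<^sup>2 \<le> 2 * (Ht0 + lamA * \<beta>0) * ?P" .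
    moreover have "(norm (xs - x t))\<^sup>2 \<le> D1\<^sup>2" using D1(2)[OF s(1) x] by (intro power_mono) auto
    moreover have "0 \<le> 2 * (Ht0 + lamA * \<beta>0) * ?P" using Ht0 lamA0 pos by simp
    ultimately have "(H t + lamA * \<beta> t) / 2 * (\<alpha> t)\<^sup>2 * (norm (xs - x t))\<^sup>2
        \<le> 2 * (Ht0 + lamA * \<beta>0) * ?P * D1\<^sup>2"
      by (rule mult_mono) simp
    then have e2: "(H t + lamA * \<beta> t) / 2 * (\<alpha> t)\<^sup>2 * (norm (xs - x t))\<^sup>2
        \<le> 2 * (Ht0 + lamA * \<beta>0) * D1\<^sup>2 * ?P" by (simp add: mult_ac)
    have "\<beta> t / 2 * (\<alpha> t)\<^sup>2 \<le> \<beta>0 * (2 * ?P)" using \<beta>\<alpha> by simp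
    moreover have "(norm (B (u t - y t)))\<^sup>2 \<le> Kb\<^sup>2" using norm_B[OF u y] by (intro power_mono) auto
    moreover have "0 \<le> \<beta>0 * (2 * ?P)" using pos by simp
    ultimately have "\<beta> t / 2 * (\<alpha> t)\<^sup>2 * (norm (B (u t - y t)))\<^sup>2 \<le> \<beta>0 * (2 * ?P) * Kb\<^sup>2"
      by (rule mult_mono) simp
    then have e3: "\<beta> t / 2 * (\<alpha> t)\<^sup>2 * (norm (B (u t - y t)))\<^sup>2 \<le> 2 * \<beta>0 * Kb\<^sup>2 * ?P"
      by (simp add: mult_ac)
    have "norm (y (Suc t) - y t) powr (\<nu> + 1) = \<alpha> t powr (\<nu> + 1) * norm (u t - y t) powr (\<nu> + 1)"
      using \<alpha>01 by (simp add: assms(42) powr_mult)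
    also have "\<dots> \<le> (4 * ?P) * D2 powr (\<nu> + 1)"
      unfolding \<alpha> using D2(2)[OF u y] exps \<rho>1
      by (intro mult_mono powr_mono2 step_size_powr_le) auto
    finally have "Mg / (\<nu> + 1) * norm (y (Suc t) - y t) powr (\<nu> + 1)
        \<le> Mg / (\<nu> + 1) * ((4 * ?P) * D2 powr (\<nu> + 1))"
      using M exps by (intro mult_left_mono) auto
    then have e4: "Mg / (\<nu> + 1) * norm (y (Suc t) - y t) powr (\<nu> + 1)
        \<le> 4 * (Mg / (\<nu> + 1)) * D2 powr (\<nu> + 1) * ?P" by (simp add: mult_ac)
    have "\<alpha> t * \<beta> t * (R t \<bullet> A (xs - x t)) + \<alpha> t * \<beta> t * (Rt t \<bullet> B (ys - y t))
        = \<alpha> t * \<beta> t * ((A (x (Suc t)) - A (x t)) \<bullet> B (ys - y t)) - \<alpha> t * \<beta> t * (norm (R t))\<^sup>2"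
      unfolding distrib_left[symmetric] right_diff_distrib[symmetric] cross ..
    \<comment> \<open>Adding the two half-steps cancels the intermediate penalty in
      \<open>Rt t\<close>.\<close>
    then have "fr (x (Suc t)) + gr (y (Suc t)) + \<beta> t / 2 * (norm (R (Suc t)))\<^sup>2
      \<le> (1 - \<alpha> t) * fr (x t) + (1 - \<alpha> t) * gr (y t) + (\<alpha> t * fr xs + \<alpha> t * gr ys)
        + \<beta> t / 2 * (norm (R t))\<^sup>2
        + \<alpha> t * \<beta> t * ((A (x (Suc t)) - A (x t)) \<bullet> B (ys - y t)) - \<alpha> t * \<beta> t * (norm (R t))\<^sup>2
        + (2 * (Ht0 + lamA * \<beta>0) * D1\<^sup>2 * ?P + 4 * m * ?P
           + 4 * (Mg / (\<nu> + 1)) * D2 powr (\<nu> + 1) * ?P + 2 * \<beta>0 * Kb\<^sup>2 * ?P)"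
      using xstep ystep e1 e2 e3 e4 fr[OF x] gr[OF y] fr[OF s(1)] gr[OF s(2)] by simp
    also have "(2 * (Ht0 + lamA * \<beta>0) * D1\<^sup>2 * ?P + 4 * m * ?P
           + 4 * (Mg / (\<nu> + 1)) * D2 powr (\<nu> + 1) * ?P + 2 * \<beta>0 * Kb\<^sup>2 * ?P) = E * ?P"
      by (simp add: E_def distrib_right)
    finally show ?thesis by (simp add: G_def algebra_simps)
  qed
  have nA: "norm (A (x t)) \<le> Ka" for t
  proof -
    have "norm (x t) \<le> norm xs + D1" using D1(2)[OF x[of t] s(1)] norm_triangle_sub[of "x t" xs] by simp
    then show ?thesis unfolding Ka_def using kA by (intro order_trans[OF kA(2)]) auto
  qed
  \<comment> \<open>The conditional gradient update moves \<open>y\<close> by only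
    \<open>\<alpha> t\<close> times a vector of bounded length; this small increment is what
    summation by parts exploits.\<close>
  have dB: "norm (B (ys - y (Suc t)) - B (ys - y t)) \<le> \<alpha> t * Kb" for t
  proof -
    have "B (ys - y (Suc t)) - B (ys - y t) = - (\<alpha> t *\<^sub>R B (u t - y t))"
      by (simp add: assms(42) linear_diff[OF lin(2)] linear_add[OF lin(2)] linear_cmul[OF lin(2)] algebra_simps)
    then show ?thesis using norm_B[OF u y, of t t] by (simp add: \<alpha> divide_right_mono)
  qed
  obtain C where C: "0 \<le> C" and rate: "\<And>t. 1 \<le> t \<Longrightarrow>
      G t + \<beta>0 / 4 * (real t + 1) powr \<delta> * (norm (R t))\<^sup>2 \<le> C * (real t + 1) powr (- \<rho>1)"
    using penalty_recursion_rate[where G = G and n = "\<lambda>t. norm (R t)" and a = "\<lambda>t. A (x t)"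
        and b = "\<lambda>t. B (ys - y t)",
        OF pos(3,4) \<rho>1(1) pos(1) E step[unfolded \<alpha> \<beta>] nA norm_B[OF s(2) y] dB[unfolded \<alpha>]]
    by blast
  have G_lower: "- K * norm (R t) \<le> G t" for t
    using lower[OF x[of t] y[of t]] by (simp add: G_def assms(38))
  \<comment> \<open>This is the constant of the quadratic inequality with
    \<open>k = \<beta>0 / 4\<close>, the penalty weight left by the recursion.\<close>
  let ?N = "2 * K / (\<beta>0 / 4) + sqrt (2 * C / (\<beta>0 / 4))"
  have rates: "norm (R t) \<le> ?N * (real t + 1) powr (- \<rho>2)"
    "\<bar>G t\<bar> \<le> (C + K * ?N) * (real t + 1) powr (- min \<rho>1 \<rho>2)" if t: "1 \<le> t" for t
  proof -
    have 1: "1 \<le> real t + 1" "0 < \<beta>0 / 4" using pos by simp_all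
    have 2: "\<rho>2 \<le> \<delta>" "\<rho>2 \<le> (\<rho>1 + \<delta>) / 2"
      unfolding \<rho>2 by (rule min.cobounded1 min.cobounded2)+
    show "norm (R t) \<le> ?N * (real t + 1) powr (- \<rho>2)"
      "\<bar>G t\<bar> \<le> (C + K * ?N) * (real t + 1) powr (- min \<rho>1 \<rho>2)"
      by (rule quadratic_penalty_rates[OF 1 K C norm_ge_zero rate[OF t] G_lower 2])+
  qed
  show "(\<lambda>t. norm (A (x t) + B (y t) - c)) \<in> O(\<lambda>t. (real t + 1) powr (-\<rho>2))"
    by (intro bigoI[where c = ?N] eventually_mono[OF eventually_ge_at_top[of 1]])
      (use rates(1) assms(38) in simp)
  show "(\<lambda>t. \<bar>real_of_ereal (f (x t)) + real_of_ereal (g (y t))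
              - real_of_ereal (f xs) - real_of_ereal (g ys)\<bar>)
        \<in> O(\<lambda>t. (real t + 1) powr (- min \<rho>1 \<rho>2))"
    by (intro bigoI[where c = "C + K * ?N"] eventually_mono[OF eventually_ge_at_top[of 1]])
      (use rates(2) in \<open>simp add: G_def fr_def gr_def diff_diff_eq\<close>)
  show "\<tau> \<in> O(\<lambda>t. Max {(real t + 1) powr (-(1 - \<delta>)), (real t + 1) powr (-\<nu>),
                          (real t + 1) powr (-\<mu>)})"
    by (rule tau_bigo[OF exps(2) assms(55)])
qed

end
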